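(* Let $(\mathcal{W},\mathcal{V})$ be an AVWC with finite alphabets $\mathcal{X},\mathcal{Y},\mathcal{Z}$, finite state set $\mathcal{S}$, cost function $c:\mathcal{S}\to[0,\infty)$ and cost constraint $\Lambda>0$ on the states. Then every real number $R\ge0$ satisfying \[ R \leq \max_{U} \Big[\min_{q\in\mathcal{P}(\mathcal{S},\Lambda)}I(U;Y_q) - \max_{q'\in\mathcal{P}(\mathcal{S},\Lambda)}\bar{I}_{q'}(U; Z_{\mathcal{S}})\Big] \] is achievable by random code (with respect to the maximal decoding error probability and the strong secrecy criterion) over that AVWC with cost constraint $\Lambda$ on the states. Here the maximum is over $U$ on a finite alphabet with joint pmf $P_{UX}$, $\Pr\{U=u,Y_q=y\}=\sum_xP_{UX}(u,x)W_q(y|x)$, $\Pr\{U=u,Z_s=z\}=\sum_xP_{UX}(u,x)V_s(z|x)$.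
   Context: AVWC $(\mathcal{W},\mathcal{V})$: $\mathcal{W}=\{W_s\}_{s\in\mathcal{S}}$ transition matrices $\mathcal{X}\to\mathcal{Y}$, $\mathcal{V}=\{V_s\}_{s\in\mathcal{S}}$ transition matrices $\mathcal{X}\to\mathcal{Z}$; $W(y^N|x^N,s^N)=\prod_iW_{s_i}(y_i|x_i)$, $V(z^N|x^N,s^N)=\prod_iV_{s_i}(z_i|x_i)$; states unknown to transmitter and receiver. $\mathcal{P}(\mathcal{S})$ = pmfs on $\mathcal{S}$; $W_q=\sum_sq(s)W_s$. For $q\in\mathcal{P}(\mathcal{S})$, $\bar I_q(U;Z_{\mathcal{S}})=\sum_{s\in\mathcal{S}}q(s)I(U;Z_s)$. Costs: $c(s^N)=\frac1N\sum_{i=1}^Nc(s_i)$, $c(q)=\sum_sc(s)q(s)$, $\mathcal{P}(\mathcal{S},\Lambda)=\{q\in\mathcal{P}(\mathcal{S}):c(q)\le\Lambda\}$. A random code of length $N$ is a random pair $(F,\Phi)$ over a finite family $\{(f_g,\phi_g)\}$ of deterministic codes $f_g:\mathcal{M}\to\mathcal{X}^N$, $\phi_g:\mathcal{Y}^N\to\mathcal{M}$. For $s^N$, $\lambda(\mathcal{W},F,\Phi,s^N)=\max_mE[1-W(\Phi^{-1}(m)|F(m),s^N)]$ with $W(D|x^N,s^N)=\sum_{y^N\in D}W(y^N|x^N,s^N)$, and $\lambda(\mathcal{W},F,\Phi,\Lambda)=\max_{s^N:c(s^N)\le\Lambda}\lambda(\mathcal{W},F,\Phi,s^N)$. $M$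 is uniform on $\mathcal{M}$ and independent of $(F,\Phi)$, $X^N=F(M)$, and $Z^N(s^N)$ satisfies $\Pr\{Z^N(s^N)=z^N|X^N=x^N,M,F,\Phi\}=V(z^N|x^N,s^N)$. $R\ge0$ is achievable by random code over the AVWC with cost constraint $\Lambda$ if for every $\epsilon>0$ and all sufficiently large $N$ there is a random code with $\frac1N\log|\mathcal{M}|>R-\epsilon$, $\lambda(\mathcal{W},F,\Phi,\Lambda)<\epsilon$ and $\max_{s^N:c(s^N)\le\Lambda}I(M;Z^N(s^N)|\Phi)<\epsilon$. *)

theory Defs
  imports Complex_Main "HOL-Library.FuncSet"
begin

(* All information quantities are measured in bits (log base 2), consistently with the rate
   (1/N) log |M|. *)

definition mutual_info :: "'a set \<Rightarrow> 'b set \<Rightarrow> ('a \<Rightarrow> 'b \<Rightarrow> real) \<Rightarrow> real" where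
  "mutual_info A B P =
     (\<Sum>a\<in>A. \<Sum>b\<in>B. if P a b = 0 then 0
        else P a b * log 2 (P a b / ((\<Sum>b'\<in>B. P a b') * (\<Sum>a'\<in>A. P a' b))))"

definition cond_mutual_info ::
  "'a set \<Rightarrow> 'b set \<Rightarrow> 'c set \<Rightarrow> ('a \<Rightarrow> 'b \<Rightarrow> 'c \<Rightarrow> real) \<Rightarrow> real" where
  "cond_mutual_info A B C P =
     (\<Sum>a\<in>A. \<Sum>b\<in>B. \<Sum>c\<in>C. if P a b c = 0 then 0
        else P a b c * log 2 (P a b c * (\<Sum>a'\<in>A. \<Sum>b'\<in>B. P a' b' c)
               / ((\<Sum>b'\<in>B. P a b' c) * (\<Sum>a'\<in>A. P a' b c))))"

text \<open>A family of transition matrices indexed by states: W s x y = W_s(y|x).\<close>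
definition channel_family :: "('s::finite \<Rightarrow> 'x::finite \<Rightarrow> 'y::finite \<Rightarrow> real) \<Rightarrow> bool" where
  "channel_family W \<longleftrightarrow> (\<forall>s x y. 0 \<le> W s x y) \<and> (\<forall>s x. (\<Sum>y\<in>UNIV. W s x y) = 1)"

definition is_pmf :: "('s::finite \<Rightarrow> real) \<Rightarrow> bool" where
  "is_pmf q \<longleftrightarrow> (\<forall>s. 0 \<le> q s) \<and> (\<Sum>s\<in>UNIV. q s) = 1"

definition cost_pmf :: "('s::finite \<Rightarrow> real) \<Rightarrow> ('s \<Rightarrow> real) \<Rightarrow> real" where
  "cost_pmf c q = (\<Sum>s\<in>UNIV. c s * q s)"

definition pmfs_cost :: "('s::finite \<Rightarrow> real) \<Rightarrow> real \<Rightarrow> ('s \<Rightarrow> real) set" where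
  "pmfs_cost c \<Lambda> = {q. is_pmf q \<and> cost_pmf c q \<le> \<Lambda>}"

definition avg_channel :: "('s::finite \<Rightarrow> 'x \<Rightarrow> 'y \<Rightarrow> real) \<Rightarrow> ('s \<Rightarrow> real) \<Rightarrow> 'x \<Rightarrow> 'y \<Rightarrow> real" where
  "avg_channel W q x y = (\<Sum>s\<in>UNIV. q s * W s x y)"

text \<open>Auxiliary variable U on the finite alphabet {..<k} with joint pmf PUX on {..<k} x X.\<close>
definition is_aux_pmf :: "nat \<Rightarrow> (nat \<Rightarrow> 'x::finite \<Rightarrow> real) \<Rightarrow> bool" where
  "is_aux_pmf k PUX \<longleftrightarrow> (\<forall>u x. 0 \<le> PUX u x) \<and> (\<Sum>u<k. \<Sum>x\<in>UNIV. PUX u x) = 1"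

definition mi_aux :: "nat \<Rightarrow> (nat \<Rightarrow> 'x::finite \<Rightarrow> real) \<Rightarrow> ('x \<Rightarrow> 'y::finite \<Rightarrow> real) \<Rightarrow> real" where
  "mi_aux k PUX T = mutual_info {..<k} UNIV (\<lambda>u y. \<Sum>x\<in>UNIV. PUX u x * T x y)"

definition avg_mi_aux ::
  "nat \<Rightarrow> (nat \<Rightarrow> 'x::finite \<Rightarrow> real) \<Rightarrow> ('s::finite \<Rightarrow> 'x \<Rightarrow> 'z::finite \<Rightarrow> real) \<Rightarrow> ('s \<Rightarrow> real) \<Rightarrow> real" where
  "avg_mi_aux k PUX V q = (\<Sum>s\<in>UNIV. q s * mi_aux k PUX (V s))"

definition block_prob :: "('s \<Rightarrow> 'x \<Rightarrow> 'y \<Rightarrow> real) \<Rightarrow> 'y list \<Rightarrow> 'x list \<Rightarrow> 's list \<Rightarrow> real" where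
  "block_prob W ys xs ss = (\<Prod>i<length ss. W (ss ! i) (xs ! i) (ys ! i))"

definition seqs :: "nat \<Rightarrow> 'a set \<Rightarrow> 'a list set" where
  "seqs N A = {xs. length xs = N \<and> set xs \<subseteq> A}"

definition cost_seq :: "('s \<Rightarrow> real) \<Rightarrow> 's list \<Rightarrow> real" where
  "cost_seq c ss = (\<Sum>i<length ss. c (ss ! i)) / real (length ss)"

text \<open>Random code of length N with message set {..<Mn}: a finite family of deterministic codes
  (f g, phi g), indexed by g in the finite set G, chosen with probability pi g.\<close>
definition random_code ::
  "nat \<Rightarrow> nat \<Rightarrow> nat set \<Rightarrow> (nat \<Rightarrow> real) \<Rightarrow> (nat \<Rightarrow> nat \<Rightarrow> 'x list) \<Rightarrow> (nat \<Rightarrow> 'y list \<Rightarrow> nat) \<Rightarrow> bool" where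
  "random_code N Mn G \<pi> f \<phi> \<longleftrightarrow>
     0 < Mn \<and> finite G \<and> (\<forall>g\<in>G. 0 \<le> \<pi> g) \<and> (\<Sum>g\<in>G. \<pi> g) = 1 \<and>
     (\<forall>g\<in>G. \<forall>m<Mn. length (f g m) = N) \<and>
     (\<forall>g\<in>G. \<forall>ys\<in>seqs N UNIV. \<phi> g ys < Mn)"

definition max_err ::
  "('s \<Rightarrow> 'x \<Rightarrow> 'y::finite \<Rightarrow> real) \<Rightarrow> nat \<Rightarrow> nat \<Rightarrow> nat set \<Rightarrow> (nat \<Rightarrow> real) \<Rightarrow>
   (nat \<Rightarrow> nat \<Rightarrow> 'x list) \<Rightarrow> (nat \<Rightarrow> 'y list \<Rightarrow> nat) \<Rightarrow> 's list \<Rightarrow> real" where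
  "max_err W N Mn G \<pi> f \<phi> ss =
     Max ((\<lambda>m. \<Sum>g\<in>G. \<pi> g *
              (1 - (\<Sum>ys\<in>{ys\<in>seqs N UNIV. \<phi> g ys = m}. block_prob W ys (f g m) ss))) ` {..<Mn})"

text \<open>Joint pmf of (M, Z^N(ss), Phi), Phi being the decoder restricted to Y^N.\<close>
definition secrecy_joint ::
  "('s \<Rightarrow> 'x \<Rightarrow> 'z \<Rightarrow> real) \<Rightarrow> nat \<Rightarrow> nat \<Rightarrow> nat set \<Rightarrow> (nat \<Rightarrow> real) \<Rightarrow>
   (nat \<Rightarrow> nat \<Rightarrow> 'x list) \<Rightarrow> (nat \<Rightarrow> 'y::finite list \<Rightarrow> nat) \<Rightarrow> 's list \<Rightarrow>
   nat \<Rightarrow> 'z list \<Rightarrow> ('y list \<Rightarrow> nat) \<Rightarrow> real" where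
  "secrecy_joint V N Mn G \<pi> f \<phi> ss m zs d =
     (\<Sum>g\<in>{g\<in>G. restrict (\<phi> g) (seqs N UNIV) = d}. \<pi> g * (1 / real Mn) * block_prob V zs (f g m) ss)"

definition secrecy_leak ::
  "('s \<Rightarrow> 'x \<Rightarrow> 'z::finite \<Rightarrow> real) \<Rightarrow> nat \<Rightarrow> nat \<Rightarrow> nat set \<Rightarrow> (nat \<Rightarrow> real) \<Rightarrow>
   (nat \<Rightarrow> nat \<Rightarrow> 'x list) \<Rightarrow> (nat \<Rightarrow> 'y::finite list \<Rightarrow> nat) \<Rightarrow> 's list \<Rightarrow> real" where
  "secrecy_leak V N Mn G \<pi> f \<phi> ss =
     cond_mutual_info {..<Mn} (seqs N UNIV) ((\<lambda>g. restrict (\<phi> g) (seqs N UNIV)) ` G)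
       (secrecy_joint V N Mn G \<pi> f \<phi> ss)"

definition achievable_random ::
  "('s::finite \<Rightarrow> 'x::finite \<Rightarrow> 'y::finite \<Rightarrow> real) \<Rightarrow> ('s \<Rightarrow> 'x \<Rightarrow> 'z::finite \<Rightarrow> real) \<Rightarrow>
   ('s \<Rightarrow> real) \<Rightarrow> real \<Rightarrow> real \<Rightarrow> bool" where
  "achievable_random W V c \<Lambda> R \<longleftrightarrow> 0 \<le> R \<and>
     (\<forall>\<epsilon>>0. \<exists>N0. \<forall>N\<ge>N0. \<exists>Mn G \<pi> f (\<phi> :: nat \<Rightarrow> 'y list \<Rightarrow> nat).
        random_code N Mn G \<pi> f \<phi> \<and>
        log 2 (real Mn) / real N > R - \<epsilon> \<and>
        (\<forall>ss\<in>seqs N UNIV. cost_seq c ss \<le> \<Lambda> \<longrightarrow> max_err W N Mn G \<pi> f \<phi> ss < \<epsilon>) \<and>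
        (\<forall>ss\<in>seqs N UNIV. cost_seq c ss \<le> \<Lambda> \<longrightarrow> secrecy_leak V N Mn G \<pi> f \<phi> ss < \<epsilon>))"

end

theory Submission
  imports Defs "HOL-Analysis.Analysis"
begin

text \<open>
  The common randomness is a codebook of i.i.d. words \<open>U\<^sup>N(m, l)\<close>; the sender picks \<open>l\<close> uniformly
  and passes the word through the test channel \<open>P(x|u)\<close>. Since the leakage is averaged over the
  codebook, no state sequence has to be treated uniformly: by convexity it is at most the expected
  divergence of the output of a random subcodebook from the product output distribution, and soft
  covering makes this exponentially small once the rate of \<open>l\<close> exceeds the average of
  \<open>I(U;Z\<^sub>s)\<close> over the empirical distribution of the state sequence.

  The decoder compares a single additive score with a threshold. The score is the information
  density of the channel \<open>W\<^sub>q\<close> that (nearly) minimises \<open>I(U;Y\<^sub>q)\<close>. As the admissible \<open>q\<close> form a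
  convex set, the first-order optimality condition gives the score a mean of at least the minimum
  under every admissible \<open>q\<close>, in particular under the empirical distribution of every admissible
  state sequence, whereas a wrong codeword exceeds the threshold \<open>a\<close> with probability at most
  \<open>exp (- a)\<close> whatever the state sequence is. Both tails are controlled by Chernoff bounds, so no
  method of types is needed.
\<close>

section \<open>Sums over product sets\<close>

text \<open>A random code consists of deterministic maps, and the leakage is conditioned on the
  decoder alone. The construction lives on this asymmetry: private encoder randomness is drawn in
  advance and hidden in the code index, while the decoder is a function of the codebook only, so
  conditioning on it averages the private choices out. Distinct codebooks may share a decoder;
  conditioning on the coarser variable is harmless, because refining it to the codebook can only
  enlarge the divergence bound.

  The ensemble itself is the code. No good codebook is selected from it, hence each state sequence
  may be bounded separately although there are exponentially many. Since all estimates factor over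
  positions, a state sequence enters only through sums of per-letter means.

  The inequality \<open>ln x \<le> x - 1\<close> does most of the analytic work: it replaces
  Jensen's inequality for the leakage and for soft covering, and it yields the second-order
  expansion behind the optimality condition. Working with finite differences instead of derivatives
  leaves only explicit remainders to control.\<close>

lemma finite_seqs: "finite A \<Longrightarrow> finite (seqs N A)"
  unfolding seqs_def by (rule finite_subset[OF _ finite_lists_length_eq[of A N]]) auto

lemma seqs_Suc: "seqs (Suc N) A = (\<lambda>(a, xs). a # xs) ` (A \<times> seqs N A)"
proof (intro set_eqI iffI)
  fix xs assume "xs \<in> seqs (Suc N) A"
  then show "xs \<in> (\<lambda>(a, xs). a # xs) ` (A \<times> seqs N A)"
    by (cases xs) (auto simp: seqs_def)
qed (auto simp: seqs_def)

text \<open>Computes expectations of functions of a word that factor over its letters. The factors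
  may depend on the position, which is how an arbitrary state sequence enters.\<close>

lemma sum_seqs_prod:
  fixes g :: "nat \<Rightarrow> 'a \<Rightarrow> real"
  shows "(\<Sum>xs\<in>seqs N A. \<Prod>i<N. g i (xs ! i)) = (\<Prod>i<N. \<Sum>a\<in>A. g i a)"
proof (induction N arbitrary: g)
  case 0
  have "seqs 0 A = {[]}" by (auto simp: seqs_def)
  then show ?case by simp
next
  case (Suc N)
  have inj: "inj_on (\<lambda>(a, xs). a # xs) (A \<times> seqs N A)"
    by (auto simp: inj_on_def)
  have "(\<Sum>xs\<in>seqs (Suc N) A. \<Prod>i<Suc N. g i (xs ! i))
      = (\<Sum>(a, xs)\<in>A \<times> seqs N A. g 0 a * (\<Prod>i<N. g (Suc i) (xs ! i)))"
    unfolding seqs_Suc sum.reindex[OF inj]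
    by (auto intro!: sum.cong simp: prod.lessThan_Suc_shift simp del: prod.lessThan_Suc)
  also have "\<dots> = (\<Sum>a\<in>A. g 0 a) * (\<Sum>xs\<in>seqs N A. \<Prod>i<N. g (Suc i) (xs ! i))"
    by (simp add: sum.cartesian_product[symmetric] sum_product)
  also have "\<dots> = (\<Prod>i<Suc N. \<Sum>a\<in>A. g i a)"
    by (subst Suc.IH) (simp add: prod.lessThan_Suc_shift del: prod.lessThan_Suc)
  finally show ?case .
qed

lemma sum_seqs_prod2:
  fixes g :: "nat \<Rightarrow> 'a \<Rightarrow> 'b \<Rightarrow> real"
  shows "(\<Sum>us\<in>seqs N A. \<Sum>ys\<in>seqs N B. \<Prod>i<N. g i (us ! i) (ys ! i))
       = (\<Prod>i<N. \<Sum>a\<in>A. \<Sum>b\<in>B. g i a b)"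
proof -
  have "(\<Sum>us\<in>seqs N A. \<Sum>ys\<in>seqs N B. \<Prod>i<N. g i (us ! i) (ys ! i))
      = (\<Sum>us\<in>seqs N A. \<Prod>i<N. \<Sum>b\<in>B. g i (us ! i) b)"
    by (intro sum.cong refl) (rule sum_seqs_prod)
  also have "\<dots> = (\<Prod>i<N. \<Sum>a\<in>A. \<Sum>b\<in>B. g i a b)"
    by (rule sum_seqs_prod)
  finally show ?thesis .
qed

section \<open>Marginals of a codebook of independent words\<close>

lemma sum_PiE_insert:
  assumes "i \<notin> J"
  shows "(\<Sum>C\<in>PiE (insert i J) A. F C) = (\<Sum>a\<in>A i. \<Sum>C\<in>PiE J A. F (C(i := a)))"
proof -
  have "(\<Sum>C\<in>PiE (insert i J) A. F C) = (\<Sum>(a, C)\<in>A i \<times> PiE J A. F (C(i := a)))"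
    unfolding PiE_insert_eq by (subst sum.reindex[OF inj_combinator[OF assms]])
      (auto intro!: sum.cong)
  then show ?thesis by (simp add: sum.cartesian_product)
qed

lemma sum_PiE_weight:
  fixes w :: "'i \<Rightarrow> 'a \<Rightarrow> real"
  assumes "finite J" "\<And>j. j \<in> J \<Longrightarrow> finite (A j)" "\<And>j. j \<in> J \<Longrightarrow> (\<Sum>a\<in>A j. w j a) = 1"
  shows "(\<Sum>C\<in>PiE J A. \<Prod>j\<in>J. w j (C j)) = 1"
  using prod_sum_PiE[of J A w] assms by simp

lemma sum_PiE_weight_marginal:
  fixes w :: "'i \<Rightarrow> 'a \<Rightarrow> real"
  assumes "finite J" "\<And>j. j \<in> J \<Longrightarrow> finite (A j)" "\<And>j. j \<in> J \<Longrightarrow> (\<Sum>a\<in>A j. w j a) = 1" "i \<in> J"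
  shows "(\<Sum>C\<in>PiE J A. (\<Prod>j\<in>J. w j (C j)) * h (C i)) = (\<Sum>a\<in>A i. w i a * h a)"
proof -
  have J: "J = insert i (J - {i})" using assms by auto
  have "(\<Sum>C\<in>PiE J A. (\<Prod>j\<in>J. w j (C j)) * h (C i))
     = (\<Sum>a\<in>A i. \<Sum>C\<in>PiE (J - {i}) A. w i a * h a * (\<Prod>j\<in>J - {i}. w j (C j)))"
    by (subst J, subst sum_PiE_insert, simp, intro sum.cong refl,
        subst prod.remove[of J i for J], use assms in \<open>auto intro!: prod.cong\<close>)
  also have "\<dots> = (\<Sum>a\<in>A i. w i a * h a)"
    unfolding sum_distrib_left[symmetric]
    by (subst sum_PiE_weight) (use assms in auto)
  finally show ?thesis .
qed

text \<open>Pairwise independence of codewords, the strongest form of independence that soft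
  covering and the false-codeword bound draw on.\<close>

lemma sum_PiE_weight_marginal2:
  fixes w :: "'i \<Rightarrow> 'a \<Rightarrow> real"
  assumes "finite J" "\<And>j. j \<in> J \<Longrightarrow> finite (A j)" "\<And>j. j \<in> J \<Longrightarrow> (\<Sum>a\<in>A j. w j a) = 1"
    and "i \<in> J" "k \<in> J" "i \<noteq> k"
  shows "(\<Sum>C\<in>PiE J A. (\<Prod>j\<in>J. w j (C j)) * h (C i) (C k))
       = (\<Sum>a\<in>A i. w i a * (\<Sum>b\<in>A k. w k b * h a b))"
proof -
  have J: "J = insert i (J - {i})" using assms by auto
  have "(\<Sum>C\<in>PiE J A. (\<Prod>j\<in>J. w j (C j)) * h (C i) (C k))
     = (\<Sum>a\<in>A i. \<Sum>C\<in>PiE (J - {i}) A. w i a * ((\<Prod>j\<in>J - {i}. w j (C j)) * h a (C k)))"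
    by (subst J, subst sum_PiE_insert, simp, intro sum.cong refl,
        subst prod.remove[of J i for J], use assms in \<open>auto intro!: prod.cong\<close>)
  also have "\<dots> = (\<Sum>a\<in>A i. w i a * (\<Sum>b\<in>A k. w k b * h a b))"
    unfolding sum_distrib_left[symmetric]
    by (subst sum_PiE_weight_marginal) (use assms in auto)
  finally show ?thesis .
qed

section \<open>Stochastic encoders\<close>

text \<open>Derandomises the encoder: a code index is a pair of a codebook \<open>C\<close> and a
  table \<open>t\<close> of inputs, drawn in advance and independently for the messages. The decoder
  reads \<open>C\<close> only. Error probabilities and joint laws involve one message at a time, so
  only one entry of \<open>t\<close> matters and the rest sums to 1.\<close>

lemma random_code_of_stochastic_encoder:
  fixes \<mu> :: "'k \<Rightarrow> real" and e :: "'k \<Rightarrow> nat \<Rightarrow> 'x::finite list \<Rightarrow> real"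
    and \<psi> :: "'k \<Rightarrow> 'y::finite list \<Rightarrow> nat"
  assumes "finite K" and \<mu>: "\<And>C. C \<in> K \<Longrightarrow> 0 \<le> \<mu> C" "(\<Sum>C\<in>K. \<mu> C) = 1" and "0 < Mn"
    and e: "\<And>C m xs. C \<in> K \<Longrightarrow> m < Mn \<Longrightarrow> 0 \<le> e C m xs"
      "\<And>C m. C \<in> K \<Longrightarrow> m < Mn \<Longrightarrow> (\<Sum>xs\<in>seqs N UNIV. e C m xs) = 1"
    and \<psi>: "\<And>C ys. C \<in> K \<Longrightarrow> ys \<in> seqs N UNIV \<Longrightarrow> \<psi> C ys < Mn"
  obtains G \<pi> f \<phi> where "random_code N Mn G \<pi> f \<phi>"
    and "\<And>m F. m < Mn \<Longrightarrow> (\<Sum>g\<in>G. \<pi> g * F (\<phi> g) (f g m))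
            = (\<Sum>C\<in>K. \<mu> C * (\<Sum>xs\<in>seqs N UNIV. e C m xs * (F (\<psi> C) xs :: real)))"
    and "\<phi> ` G = \<psi> ` K"
proof -
  let ?X = "seqs N (UNIV :: 'x set)"
  define T where "T = PiE {..<Mn} (\<lambda>_. ?X)"
  define S where "S = K \<times> T"
  have finX: "finite ?X" by (simp add: finite_seqs)
  \<comment> \<open>Since \<open>T\<close> is nonempty, every codebook occurs as a first component
    of \<open>S\<close>; this gives the equality of decoder images at the end.\<close>
  have "replicate N undefined \<in> ?X" by (simp add: seqs_def)
  then have Tne: "T \<noteq> {}" unfolding T_def by (auto simp: PiE_eq_empty_iff)
  have finT: "finite T" unfolding T_def by (intro finite_PiE) (auto simp: finX)
  then have "finite S" unfolding S_def using assms by auto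
  then obtain h where h: "bij_betw h {0..<card S} S" using ex_bij_betw_nat_finite by blast
  define G where "G = {0..<card S}"
  define \<pi> where "\<pi> g = \<mu> (fst (h g)) * (\<Prod>m<Mn. e (fst (h g)) m (snd (h g) m))" for g
  define f where "f g = snd (h g)" for g
  define \<phi> where "\<phi> g = \<psi> (fst (h g))" for g
  have hG: "h ` G = S" using h by (simp add: bij_betw_def G_def)
  then have hgK: "fst (h g) \<in> K \<and> snd (h g) \<in> T" if "g \<in> G" for g
    using that imageI[of g G h] by (auto simp: S_def mem_Times_iff)
  have reindex: "(\<Sum>g\<in>G. F (h g)) = (\<Sum>C\<in>K. \<Sum>t\<in>T. F (C, t))" for F :: "_ \<Rightarrow> real"
    using sum.reindex_bij_betw[OF h, of F] by (simp add: G_def S_def sum.cartesian_product)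
  have main: "(\<Sum>g\<in>G. \<pi> g * F (\<phi> g) (f g m))
            = (\<Sum>C\<in>K. \<mu> C * (\<Sum>xs\<in>?X. e C m xs * F (\<psi> C) xs))" if m: "m < Mn" for m F
  proof -
    have "(\<Sum>g\<in>G. \<pi> g * F (\<phi> g) (f g m))
      = (\<Sum>C\<in>K. \<Sum>t\<in>T. \<mu> C * ((\<Prod>m<Mn. e C m (t m)) * F (\<psi> C) (t m)))"
      unfolding \<pi>_def \<phi>_def f_def
      using reindex[of "\<lambda>p. \<mu> (fst p) * (\<Prod>m<Mn. e (fst p) m (snd p m)) * F (\<psi> (fst p)) (snd p m)"]
      by (simp add: mult.assoc)
    also have "\<dots> = (\<Sum>C\<in>K. \<mu> C * (\<Sum>xs\<in>?X. e C m xs * F (\<psi> C) xs))"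
      unfolding T_def sum_distrib_left[symmetric]
      by (intro sum.cong refl, subst sum_PiE_weight_marginal) (use m e finX in auto)
    finally show ?thesis .
  qed
  have "(\<Sum>g\<in>G. \<pi> g) = 1"
    using main[of 0 "\<lambda>_ _. 1"] \<open>0 < Mn\<close> e \<mu> by simp
  moreover have "0 \<le> \<pi> g" if "g \<in> G" for g
    unfolding \<pi>_def using hgK[OF that] \<mu> e by (auto intro!: mult_nonneg_nonneg prod_nonneg)
  moreover have "length (f g m) = N" if "g \<in> G" "m < Mn" for g m
    using hgK[OF that(1)] that by (auto simp: f_def T_def seqs_def PiE_def Pi_def)
  moreover have "\<phi> g ys < Mn" if "g \<in> G" "ys \<in> seqs N UNIV" for g ys
    using hgK[OF that(1)] that \<psi> by (auto simp: \<phi>_def)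
  ultimately have "random_code N Mn G \<pi> f \<phi>"
    using \<open>0 < Mn\<close> by (auto simp: random_code_def G_def)
  moreover have "\<phi> ` G = \<psi> ` K"
  proof -
    have "\<phi> ` G = (\<lambda>p. \<psi> (fst p)) ` S" unfolding hG[symmetric] by (auto simp: \<phi>_def)
    also have "\<dots> = \<psi> ` K" unfolding S_def using Tne by force
    finally show ?thesis .
  qed
  ultimately show thesis using main that by blast
qed

section \<open>Leakage and soft covering\<close>

lemma sum_rotate:
  "(\<Sum>m\<in>M. \<Sum>z\<in>Z. \<Sum>C\<in>K. f C m z) = (\<Sum>C\<in>K. \<Sum>m\<in>M. \<Sum>z\<in>Z. (f C m z :: real))"
proof -
  have "(\<Sum>m\<in>M. \<Sum>z\<in>Z. \<Sum>C\<in>K. f C m z) = (\<Sum>m\<in>M. \<Sum>C\<in>K. \<Sum>z\<in>Z. f C m z)"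
    by (intro sum.cong refl) (rule sum.swap)
  also have "\<dots> = (\<Sum>C\<in>K. \<Sum>m\<in>M. \<Sum>z\<in>Z. f C m z)" by (rule sum.swap)
  finally show ?thesis .
qed

text \<open>The conditional information is the least mean divergence from output laws depending on
  the decoder only, so \<open>Q\<close> in place of the true law can only increase it; refining the
  decoder to the codebook increases it again by convexity. A single tangent inequality settles both
  at once.\<close>

lemma cond_mutual_info_le_divergence:
  fixes \<mu> :: "'k \<Rightarrow> real" and r :: "'k \<Rightarrow> 'd" and T :: "'k \<Rightarrow> nat \<Rightarrow> 'z \<Rightarrow> real"
  assumes fin: "finite K" "finite Z" and Mn: "0 < Mn"
    and \<mu>: "\<And>C. C \<in> K \<Longrightarrow> 0 < \<mu> C"
    and T: "\<And>C m z. C \<in> K \<Longrightarrow> m < Mn \<Longrightarrow> z \<in> Z \<Longrightarrow> 0 \<le> T C m z"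
      "\<And>C m. C \<in> K \<Longrightarrow> m < Mn \<Longrightarrow> (\<Sum>z\<in>Z. T C m z) = 1"
    and Q: "\<And>z. z \<in> Z \<Longrightarrow> 0 \<le> Q z" "(\<Sum>z\<in>Z. Q z) = 1"
      "\<And>C m z. C \<in> K \<Longrightarrow> m < Mn \<Longrightarrow> z \<in> Z \<Longrightarrow> Q z = 0 \<Longrightarrow> T C m z = 0"
    and p: "\<And>m z d. m < Mn \<Longrightarrow> z \<in> Z \<Longrightarrow> d \<in> r ` K \<Longrightarrow>
              p m z d = (\<Sum>C\<in>{C\<in>K. r C = d}. \<mu> C / real Mn * T C m z)"
  shows "cond_mutual_info {..<Mn} Z (r ` K) p
       \<le> (\<Sum>m<Mn. \<Sum>C\<in>K. \<mu> C * (\<Sum>z\<in>Z. T C m z * ln (T C m z / Q z))) / (real Mn * ln 2)"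
proof -
  define a where "a C m z = \<mu> C / real Mn * T C m z" for C m z
  define pz where "pz z d = (\<Sum>m<Mn. p m z d)" for z d
  define \<nu> where "\<nu> d = (\<Sum>C\<in>{C\<in>K. r C = d}. \<mu> C)" for d
  have p': "p m z d = (\<Sum>C\<in>{C\<in>K. r C = d}. a C m z)" if "m < Mn" "z \<in> Z" "d \<in> r ` K" for m z d
    unfolding p[OF that] a_def ..
  have a_nn: "0 \<le> a C m z" if "C \<in> K" "m < Mn" "z \<in> Z" for C m z
    unfolding a_def using \<mu>[OF that(1)] T(1)[OF that] by simp
  have p_nn: "0 \<le> p m z d" if "m < Mn" "z \<in> Z" "d \<in> r ` K" for m z d
    unfolding p'[OF that] using that by (intro sum_nonneg a_nn) auto
  have a_le_p: "a C m z \<le> p m z (r C)" if "C \<in> K" "m < Mn" "z \<in> Z" for C m z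
    unfolding p'[OF that(2,3) imageI[OF that(1)]]
    by (rule member_le_sum) (use that a_nn fin in auto)
  have p_le_pz: "p m z d \<le> pz z d" if "m < Mn" "z \<in> Z" "d \<in> r ` K" for m z d
    unfolding pz_def by (rule member_le_sum) (use that p_nn in auto)
  have \<nu>_pos: "0 < \<nu> d" if "d \<in> r ` K" for d
    unfolding \<nu>_def using that \<mu> fin by (intro sum_pos) auto
  have pm: "(\<Sum>z\<in>Z. p m z d) = \<nu> d / real Mn" if "m < Mn" "d \<in> r ` K" for m d
  proof -
    have "(\<Sum>z\<in>Z. p m z d) = (\<Sum>z\<in>Z. \<Sum>C\<in>{C\<in>K. r C = d}. a C m z)"
      by (intro sum.cong refl p') (use that in auto)
    also have "\<dots> = (\<Sum>C\<in>{C\<in>K. r C = d}. \<mu> C / real Mn * (\<Sum>z\<in>Z. T C m z))"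
      by (subst sum.swap) (simp add: a_def sum_distrib_left)
    also have "\<dots> = \<nu> d / real Mn"
      unfolding \<nu>_def sum_divide_distrib using T(2) that by (intro sum.cong) auto
    finally show ?thesis .
  qed
  have pd: "(\<Sum>m<Mn. \<Sum>z\<in>Z. p m z d) = \<nu> d" if "d \<in> r ` K" for d
    using pm[OF _ that] Mn by simp
  \<comment> \<open>The message is uniform and independent of the decoder, so the ratio inside the
    conditional information reduces to this likelihood ratio of \<open>z\<close> given message and
    decoder against \<open>z\<close> given the decoder.\<close>
  let ?g = "\<lambda>C m z. Mn * p m z (r C) / pz z (r C)"
  have "cond_mutual_info {..<Mn} Z (r ` K) p
      = (\<Sum>m<Mn. \<Sum>z\<in>Z. \<Sum>d\<in>r ` K. p m z d * log 2 (Mn * p m z d / pz z d))"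
    unfolding cond_mutual_info_def
  proof (intro sum.cong refl)
    fix m z d assume A: "m \<in> {..<Mn}" "z \<in> Z" "d \<in> r ` K"
    then have "p m z d * (\<Sum>m<Mn. \<Sum>z\<in>Z. p m z d) / ((\<Sum>z\<in>Z. p m z d) * (\<Sum>m<Mn. p m z d))
        = Mn * p m z d / pz z d"
      using \<nu>_pos[of d] Mn by (simp add: pd pm pz_def)
    then show "(if p m z d = 0 then 0 else p m z d * log 2 (p m z d * (\<Sum>m<Mn. \<Sum>z\<in>Z. p m z d)
          / ((\<Sum>z\<in>Z. p m z d) * (\<Sum>m<Mn. p m z d)))) = p m z d * log 2 (Mn * p m z d / pz z d)"
      by simp
  qed
  also have "\<dots> = (\<Sum>m<Mn. \<Sum>z\<in>Z. \<Sum>C\<in>K. a C m z * log 2 (?g C m z))"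
  proof (intro sum.cong refl)
    fix m z assume A: "m \<in> {..<Mn}" "z \<in> Z"
    have "(\<Sum>d\<in>r ` K. p m z d * log 2 (Mn * p m z d / pz z d))
        = (\<Sum>d\<in>r ` K. \<Sum>C\<in>{C\<in>K. r C = d}. a C m z * log 2 (?g C m z))"
      using A by (intro sum.cong refl) (simp add: p'[symmetric] sum_distrib_right[symmetric])
    also have "\<dots> = (\<Sum>C\<in>K. a C m z * log 2 (?g C m z))"
      by (rule sum.group) (use fin in auto)
    finally show "(\<Sum>d\<in>r ` K. p m z d * log 2 (Mn * p m z d / pz z d))
        = (\<Sum>C\<in>K. a C m z * log 2 (?g C m z))" .
  qed
  also have "\<dots> = (\<Sum>m<Mn. \<Sum>z\<in>Z. \<Sum>C\<in>K. a C m z * ln (?g C m z)) / ln 2"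
    by (simp add: log_def sum_divide_distrib)
  also have "\<dots> \<le> (\<Sum>m<Mn. \<Sum>z\<in>Z. \<Sum>C\<in>K. a C m z * ln (T C m z / Q z)) / ln 2"
  proof (rule divide_right_mono)
    \<comment> \<open>\<open>ln x \<le> x - 1\<close> for the quotient of the two likelihood ratios.
      After multiplication by \<open>a C m z\<close> the factor \<open>T C m z\<close> cancels, and
      what remains can be summed over \<open>m\<close>.\<close>
    have tangent: "a C m z * ln (?g C m z) - a C m z * ln (T C m z / Q z)
        \<le> \<mu> C * Q z * p m z (r C) / pz z (r C) - a C m z"
      if A: "C \<in> K" "m < Mn" "z \<in> Z" for C m z
    proof (cases "T C m z = 0")
      case True
      then have "a C m z = 0" by (simp add: a_def)
      moreover have "0 \<le> pz z (r C)" using p_nn[of m z "r C"] p_le_pz[of m z "r C"] A by auto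
      ultimately show ?thesis using \<mu>[OF A(1)] Q(1)[OF A(3)] p_nn[of m z "r C"] A by simp
    next
      case False
      then have Tp: "0 < T C m z" using T(1)[OF A] by simp
      have Qp: "0 < Q z" using Q(1,3) A False by (metis less_eq_real_def)
      have ap: "0 < a C m z" unfolding a_def using \<mu> A Tp Mn by simp
      then have pp: "0 < p m z (r C)" using a_le_p[OF A] by linarith
      then have pzp: "0 < pz z (r C)" using p_le_pz[of m z "r C"] A by force
      have "ln (?g C m z) - ln (T C m z / Q z) = ln (?g C m z / (T C m z / Q z))"
        using Tp Qp pp pzp Mn by (subst ln_div) auto
      also have "\<dots> \<le> ?g C m z / (T C m z / Q z) - 1"
        by (rule ln_le_minus_one) (use Tp Qp pp pzp Mn in auto)
      finally have "a C m z * (ln (?g C m z) - ln (T C m z / Q z))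
          \<le> a C m z * (?g C m z / (T C m z / Q z) - 1)"
        using ap by (intro mult_left_mono) auto
      also have "\<dots> = \<mu> C * Q z * p m z (r C) / pz z (r C) - a C m z"
        unfolding a_def using Tp Qp pp pzp Mn by (simp add: field_simps)
      finally show ?thesis by (simp add: algebra_simps)
    qed
    have "(\<Sum>m<Mn. \<Sum>z\<in>Z. \<Sum>C\<in>K. a C m z * ln (?g C m z) - a C m z * ln (T C m z / Q z))
       \<le> (\<Sum>m<Mn. \<Sum>z\<in>Z. \<Sum>C\<in>K. \<mu> C * Q z * p m z (r C) / pz z (r C) - a C m z)"
      by (intro sum_mono tangent) auto
    also have "\<dots> = (\<Sum>C\<in>K. \<Sum>z\<in>Z. \<mu> C * Q z * (\<Sum>m<Mn. p m z (r C)) / pz z (r C))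
        - (\<Sum>C\<in>K. \<Sum>m<Mn. \<Sum>z\<in>Z. a C m z)"
    proof -
      have "(\<Sum>m<Mn. \<Sum>z\<in>Z. \<Sum>C\<in>K. \<mu> C * Q z * p m z (r C) / pz z (r C))
          = (\<Sum>C\<in>K. \<Sum>z\<in>Z. \<Sum>m<Mn. \<mu> C * Q z * p m z (r C) / pz z (r C))"
        by (subst sum_rotate) (intro sum.cong refl sum.swap)
      then show ?thesis
        by (simp add: sum_subtractf sum_distrib_left sum_divide_distrib sum_rotate[where M = "{..<Mn}" and Z = Z and K = K])
    qed
    also have "(\<Sum>C\<in>K. \<Sum>m<Mn. \<Sum>z\<in>Z. a C m z) = (\<Sum>C\<in>K. \<mu> C)"
    proof (intro sum.cong refl)
      fix C assume "C \<in> K"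
      then have "(\<Sum>z\<in>Z. a C m z) = \<mu> C / real Mn" if "m < Mn" for m
        unfolding a_def sum_distrib_left[symmetric] using that T(2) by simp
      then show "(\<Sum>m<Mn. \<Sum>z\<in>Z. a C m z) = \<mu> C" using Mn by simp
    qed
    \<comment> \<open>Equality wherever \<open>pz z (r C)\<close> is nonzero; where it vanishes, the
      quotient is 0 and some mass of \<open>Q\<close> is lost, which is the favourable
      direction.\<close>
    also have "(\<Sum>C\<in>K. \<Sum>z\<in>Z. \<mu> C * Q z * (\<Sum>m<Mn. p m z (r C)) / pz z (r C))
        \<le> (\<Sum>C\<in>K. \<Sum>z\<in>Z. \<mu> C * Q z)"
    proof (intro sum_mono)
      fix C z assume "C \<in> K" "z \<in> Z"
      then show "\<mu> C * Q z * (\<Sum>m<Mn. p m z (r C)) / pz z (r C) \<le> \<mu> C * Q z"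
        using \<mu>[of C] Q(1)[of z] by (cases "pz z (r C) = 0") (auto simp: pz_def)
    qed
    also have "(\<Sum>C\<in>K. \<Sum>z\<in>Z. \<mu> C * Q z) = (\<Sum>C\<in>K. \<mu> C)"
      by (simp add: sum_distrib_left[symmetric] Q(2))
    finally show "(\<Sum>m<Mn. \<Sum>z\<in>Z. \<Sum>C\<in>K. a C m z * ln (?g C m z))
        \<le> (\<Sum>m<Mn. \<Sum>z\<in>Z. \<Sum>C\<in>K. a C m z * ln (T C m z / Q z))"
      by (simp add: sum_subtractf)
  qed simp
  also have "\<dots> = (\<Sum>m<Mn. \<Sum>C\<in>K. \<mu> C * (\<Sum>z\<in>Z. T C m z * ln (T C m z / Q z))) / (real Mn * ln 2)"
    unfolding a_def by (subst sum.swap[of _ K Z]) (simp add: sum_distrib_left sum_divide_distrib mult.assoc)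
  finally show ?thesis .
qed

text \<open>Condition on one codeword \<open>C j = u\<close>. By concavity the expected logarithm is
  at most the logarithm of the conditional mean of \<open>T C z / Q z\<close>; the word itself
  contributes \<open>v u z / (L * Q z)\<close> to this mean, the other \<open>L - 1\<close>
  independent words contribute \<open>(L - 1) / L\<close>, which is at most 1.\<close>

lemma soft_covering_divergence:
  fixes p :: "'u \<Rightarrow> real" and v :: "'u \<Rightarrow> 'z \<Rightarrow> real"
  assumes fin: "finite J" "finite A" "finite Z" and S: "S \<subseteq> J" "S \<noteq> {}"
    and p: "\<And>u. u \<in> A \<Longrightarrow> 0 < p u" "(\<Sum>u\<in>A. p u) = 1"
    and v: "\<And>u z. u \<in> A \<Longrightarrow> z \<in> Z \<Longrightarrow> 0 \<le> v u z"
    and Q: "\<And>z. z \<in> Z \<Longrightarrow> Q z = (\<Sum>u\<in>A. p u * v u z)"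
    and T: "\<And>C z. T C z = (\<Sum>j\<in>S. v (C j) z) / real (card S)"
  shows "(\<Sum>C\<in>PiE J (\<lambda>_. A). (\<Prod>j\<in>J. p (C j)) * (\<Sum>z\<in>Z. T C z * ln (T C z / Q z)))
       \<le> (\<Sum>u\<in>A. \<Sum>z\<in>Z. p u * v u z * ln (1 + v u z / (real (card S) * Q z)))"
proof -
  let ?K = "PiE J (\<lambda>_. A)"
  define L where "L = real (card S)"
  have finS: "finite S" using fin S finite_subset by blast
  then have Lp: "0 < L" unfolding L_def using S by (simp add: card_gt_0_iff)
  define \<mu> where "\<mu> C = (\<Prod>j\<in>J. p (C j))" for C
  have \<mu>_nn: "0 \<le> \<mu> C" if "C \<in> ?K" for C
    unfolding \<mu>_def using that p(1) by (intro prod_nonneg) (auto simp: PiE_def Pi_def less_imp_le)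
  have marg: "(\<Sum>C\<in>?K. \<mu> C * h (C i)) = (\<Sum>u\<in>A. p u * h u)" if "i \<in> J" for h i
    unfolding \<mu>_def using sum_PiE_weight_marginal[of J "\<lambda>_. A" "\<lambda>_. p"] fin p that by simp
  have marg2: "(\<Sum>C\<in>?K. \<mu> C * h (C i) (C j)) = (\<Sum>a\<in>A. p a * (\<Sum>b\<in>A. p b * h a b))"
    if "i \<in> J" "j \<in> J" "i \<noteq> j" for h i j
    unfolding \<mu>_def using sum_PiE_weight_marginal2[of J "\<lambda>_. A" "\<lambda>_. p"] fin p that by simp
  have per_z: "(\<Sum>C\<in>?K. \<mu> C * (T C z * ln (T C z / Q z)))
      \<le> (\<Sum>u\<in>A. p u * v u z * ln (1 + v u z / (L * Q z)))" if z: "z \<in> Z" for z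
  proof (cases "Q z = 0")
    case True
    \<comment> \<open>All \<open>p u\<close> are positive, so \<open>Q z = 0\<close> forces every
      \<open>v u z\<close> to vanish, and both sides are 0.\<close>
    have "(\<Sum>u\<in>A. p u * v u z) = 0" using True Q[OF z] by simp
    then have "\<forall>u\<in>A. p u * v u z = 0"
      using fin p v z by (subst (asm) sum_nonneg_eq_0_iff) (auto simp: less_imp_le)
    then have v0: "v u z = 0" if "u \<in> A" for u using p(1)[OF that] that by force
    have "T C z = 0" if "C \<in> ?K" for C
      unfolding T using that v0 S by (auto simp: PiE_def Pi_def intro!: sum.neutral)
    then show ?thesis using v0 by simp
  next
    case False
    have "0 \<le> Q z" unfolding Q[OF z] using p v z by (intro sum_nonneg) (auto simp: less_imp_le)
    with False have Qp: "0 < Q z" by simp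
    \<comment> \<open>The bound on the conditional mean. Taking the tangent of \<open>ln\<close> at
      this point, which depends on \<open>C j\<close> only, gives Jensen's inequality without
      introducing conditional expectations.\<close>
    define x0 where "x0 u = 1 + v u z / (L * Q z)" for u
    have x0: "1 \<le> x0 u" if "u \<in> A" for u
      unfolding x0_def using v[OF that z] Qp Lp by simp
    have inA: "C j \<in> A" if "C \<in> ?K" "j \<in> S" for C j using that S by auto
    have per_j: "(\<Sum>C\<in>?K. \<mu> C * (v (C j) z * ln (T C z / Q z)))
        \<le> (\<Sum>u\<in>A. p u * (v u z * ln (x0 u)))" if j: "j \<in> S" for j
    proof -
      have tangent: "v (C j) z * ln (T C z / Q z)
         \<le> v (C j) z * ln (x0 (C j)) + v (C j) z * (T C z / Q z / x0 (C j)) - v (C j) z"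
        if C: "C \<in> ?K" for C
      proof (cases "v (C j) z = 0")
        case False
        have vp: "0 < v (C j) z" using False v[OF inA[OF C j] z] by simp
        have "v (C j) z \<le> (\<Sum>j\<in>S. v (C j) z)"
          by (rule member_le_sum) (use j finS inA C v z in auto)
        then have Tp: "0 < T C z" using vp Lp by (simp add: T L_def)
        have xp: "0 < x0 (C j)" using x0[OF inA[OF C j]] by simp
        have "ln (T C z / Q z) - ln (x0 (C j)) = ln (T C z / Q z / x0 (C j))"
          using Tp Qp xp by (intro ln_divide_pos[symmetric]) auto
        also have "\<dots> \<le> T C z / Q z / x0 (C j) - 1"
          by (rule ln_le_minus_one) (use Tp Qp xp in auto)
        finally have "v (C j) z * ln (T C z / Q z)
            \<le> v (C j) z * (ln (x0 (C j)) + T C z / Q z / x0 (C j) - 1)"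
          using vp by (intro mult_left_mono) auto
        then show ?thesis by (simp add: algebra_simps)
      qed simp
      have "(\<Sum>C\<in>?K. \<mu> C * (v (C j) z * ln (T C z / Q z)))
        \<le> (\<Sum>C\<in>?K. \<mu> C * (v (C j) z * ln (x0 (C j)) + v (C j) z * (T C z / Q z / x0 (C j)) - v (C j) z))"
        by (intro sum_mono mult_left_mono tangent \<mu>_nn)
      also have "\<dots> = (\<Sum>u\<in>A. p u * (v u z * ln (x0 u))) - (\<Sum>u\<in>A. p u * v u z)
         + (\<Sum>C\<in>?K. \<mu> C * (v (C j) z * (T C z / Q z / x0 (C j))))"
        using marg[of j "\<lambda>u. v u z * ln (x0 u)"] marg[of j "\<lambda>u. v u z"] j S
        by (auto simp: sum.distrib sum_subtractf ring_distribs)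
      also have "(\<Sum>C\<in>?K. \<mu> C * (v (C j) z * (T C z / Q z / x0 (C j))))
         = (\<Sum>i\<in>S. \<Sum>C\<in>?K. \<mu> C * (v (C j) z * v (C i) z / x0 (C j))) / (L * Q z)"
        by (subst sum.swap) (simp add: T L_def sum_divide_distrib sum_distrib_left mult_ac)
      \<comment> \<open>The diagonal term \<open>i = j\<close> needs one marginal; for the others
        the two words are independent and averaging over the second one produces
        \<open>Q z\<close>.\<close>
      also have "(\<Sum>i\<in>S. \<Sum>C\<in>?K. \<mu> C * (v (C j) z * v (C i) z / x0 (C j)))
         = (\<Sum>u\<in>A. p u * (v u z * v u z / x0 u))
           + (\<Sum>i\<in>S - {j}. \<Sum>a\<in>A. p a * (\<Sum>b\<in>A. p b * (v a z * v b z / x0 a)))"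
      proof (subst sum.remove[OF finS j], intro arg_cong2[where f="(+)"] sum.cong refl)
        show "(\<Sum>C\<in>?K. \<mu> C * (v (C j) z * v (C j) z / x0 (C j))) = (\<Sum>u\<in>A. p u * (v u z * v u z / x0 u))"
          using marg[of j "\<lambda>u. v u z * v u z / x0 u"] j S by auto
        show "(\<Sum>C\<in>?K. \<mu> C * (v (C j) z * v (C i) z / x0 (C j)))
           = (\<Sum>a\<in>A. p a * (\<Sum>b\<in>A. p b * (v a z * v b z / x0 a)))" if "i \<in> S - {j}" for i
          using marg2[of j i "\<lambda>a b. v a z * v b z / x0 a"] j S that by auto
      qed
      also have "(\<Sum>i\<in>S - {j}. \<Sum>a\<in>A. p a * (\<Sum>b\<in>A. p b * (v a z * v b z / x0 a)))
         = (L - 1) * (\<Sum>a\<in>A. p a * (v a z / x0 a * Q z))"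
      proof -
        have "real (card (S - {j})) = L - 1" using finS j S
          unfolding L_def by (simp add: of_nat_diff Suc_leI card_gt_0_iff)
        moreover have "(\<Sum>b\<in>A. p b * (v a z * v b z / x0 a)) = v a z / x0 a * Q z" for a
          unfolding Q[OF z] sum_distrib_left by (intro sum.cong) (auto simp: field_simps)
        ultimately show ?thesis by simp
      qed
      also have "((\<Sum>u\<in>A. p u * (v u z * v u z / x0 u)) + (L - 1) * (\<Sum>a\<in>A. p a * (v a z / x0 a * Q z)))
          / (L * Q z) = (\<Sum>u\<in>A. p u * (v u z / x0 u) * (v u z / (L * Q z) + (L - 1) / L))"
        unfolding sum_distrib_left sum_divide_distrib sum.distrib[symmetric]
      proof (intro sum.cong refl)
        fix u assume "u \<in> A"
        then have "0 < x0 u" using x0 by force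
        then show "(p u * (v u z * v u z / x0 u) + (L - 1) * (p u * (v u z / x0 u * Q z))) / (L * Q z)
            = p u * (v u z / x0 u) * (v u z / (L * Q z) + (L - 1) / L)"
          using Lp Qp by (simp add: field_simps)
      qed
      \<comment> \<open>The linear part of the tangent is now at most the mean of
        \<open>v u z\<close>, cancelling the subtracted term; only the \<open>ln (x0 u)\<close> part
        survives.\<close>
      also have "\<dots> \<le> (\<Sum>u\<in>A. p u * (v u z / x0 u) * x0 u)"
      proof (intro sum_mono mult_left_mono)
        fix u assume "u \<in> A"
        show "v u z / (L * Q z) + (L - 1) / L \<le> x0 u"
          unfolding x0_def using Lp by (simp add: field_simps)
        show "0 \<le> p u * (v u z / x0 u)"
          using p(1)[OF \<open>u \<in> A\<close>] v[OF \<open>u \<in> A\<close> z] x0[OF \<open>u \<in> A\<close>] by simp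
      qed
      also have "\<dots> = (\<Sum>u\<in>A. p u * v u z)"
        by (intro sum.cong refl) (use x0 in force)
      finally show ?thesis by simp
    qed
    have "(\<Sum>C\<in>?K. \<mu> C * (T C z * ln (T C z / Q z)))
        = (\<Sum>j\<in>S. \<Sum>C\<in>?K. \<mu> C * (v (C j) z * ln (T C z / Q z))) / L"
      by (subst sum.swap) (simp add: T[of _ z] L_def sum_divide_distrib sum_distrib_left sum_distrib_right mult_ac)
    also have "\<dots> \<le> (\<Sum>j\<in>S. \<Sum>u\<in>A. p u * (v u z * ln (x0 u))) / L"
      using Lp by (intro divide_right_mono sum_mono per_j) auto
    also have "\<dots> = (\<Sum>u\<in>A. p u * v u z * ln (1 + v u z / (L * Q z)))"
      using Lp by (simp add: L_def[symmetric] x0_def mult.assoc)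
    finally show ?thesis .
  qed
  have "(\<Sum>C\<in>?K. \<mu> C * (\<Sum>z\<in>Z. T C z * ln (T C z / Q z)))
     = (\<Sum>z\<in>Z. \<Sum>C\<in>?K. \<mu> C * (T C z * ln (T C z / Q z)))"
    by (subst sum.swap) (simp add: sum_distrib_left)
  also have "\<dots> \<le> (\<Sum>z\<in>Z. \<Sum>u\<in>A. p u * v u z * ln (1 + v u z / (L * Q z)))"
    by (intro sum_mono per_z)
  also have "\<dots> = (\<Sum>u\<in>A. \<Sum>z\<in>Z. p u * v u z * ln (1 + v u z / (L * Q z)))"
    by (rule sum.swap)
  finally show ?thesis unfolding \<mu>_def L_def .
qed

section \<open>Threshold decoding\<close>

text \<open>The error analysis counts any passing codeword of another message as an error. The
  default 0 keeps the output inside the message set.\<close>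

definition threshold_decoder ::
  "nat \<Rightarrow> nat \<Rightarrow> ('u \<Rightarrow> 'y \<Rightarrow> real) \<Rightarrow> real \<Rightarrow> (nat \<times> nat \<Rightarrow> 'u) \<Rightarrow> 'y \<Rightarrow> nat" where
  "threshold_decoder Mn L S a C y =
     (if \<exists>m<Mn. \<exists>l<L. a \<le> S (C (m, l)) y
      then LEAST m. m < Mn \<and> (\<exists>l<L. a \<le> S (C (m, l)) y) else 0)"

lemma threshold_decoder_less: "0 < Mn \<Longrightarrow> threshold_decoder Mn L S a C y < Mn"
  unfolding threshold_decoder_def
  by (auto intro: LeastI2[where Q = "\<lambda>m. m < Mn"])

lemma threshold_decoder_error:
  assumes "threshold_decoder Mn L S a C y \<noteq> m" "m < Mn" "l < L"
  shows "S (C (m, l)) y < a \<or> (\<exists>j\<in>({..<Mn} - {m}) \<times> {..<L}. a \<le> S (C j) y)"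
proof (rule ccontr)
  assume "\<not> ?thesis"
  then have *: "a \<le> S (C (m, l)) y"
    and **: "\<And>m' l'. m' < Mn \<Longrightarrow> l' < L \<Longrightarrow> a \<le> S (C (m', l')) y \<Longrightarrow> m' = m" by auto
  have "(LEAST m. m < Mn \<and> (\<exists>l<L. a \<le> S (C (m, l)) y)) = m"
    using * ** assms(2,3) by (intro Least_equality) blast+
  then have "threshold_decoder Mn L S a C y = m"
    using * assms(2,3) unfolding threshold_decoder_def by auto
  then show False using assms by simp
qed

text \<open>Union bound: either the sent word misses the threshold, or one of the
  \<open>(Mn - 1) * L\<close> words of other messages passes it. Further words of the same message
  do no harm. As \<open>\<beta>\<close> is uniform in \<open>y\<close>, the second part is the same
  for every channel \<open>w\<close>.\<close>

lemma threshold_decoder_error_prob: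
  fixes p :: "'u \<Rightarrow> real" and w :: "'u \<Rightarrow> 'y \<Rightarrow> real"
  assumes fin: "finite A" "finite Y" and m: "m < Mn" and L: "0 < L"
    and p: "\<And>u. u \<in> A \<Longrightarrow> 0 \<le> p u" "(\<Sum>u\<in>A. p u) = 1"
    and w: "\<And>u y. u \<in> A \<Longrightarrow> y \<in> Y \<Longrightarrow> 0 \<le> w u y" "\<And>u. u \<in> A \<Longrightarrow> (\<Sum>y\<in>Y. w u y) = 1"
    and \<beta>: "\<And>y. y \<in> Y \<Longrightarrow> (\<Sum>u\<in>A. p u * of_bool (a \<le> S u y)) \<le> \<beta>"
  shows "(\<Sum>C\<in>PiE ({..<Mn} \<times> {..<L}) (\<lambda>_. A). (\<Prod>j\<in>{..<Mn} \<times> {..<L}. p (C j)) *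
            (1 - (\<Sum>l<L. \<Sum>y\<in>{y\<in>Y. threshold_decoder Mn L S a C y = m}. w (C (m, l)) y) / real L))
       \<le> (\<Sum>u\<in>A. \<Sum>y\<in>Y. p u * w u y * of_bool (S u y < a)) + (real Mn - 1) * real L * \<beta>"
proof -
  let ?J = "{..<Mn} \<times> {..<L}" and ?J' = "({..<Mn} - {m}) \<times> {..<L}"
  let ?K = "PiE ?J (\<lambda>_. A)"
  define \<mu> where "\<mu> C = (\<Prod>j\<in>?J. p (C j))" for C
  have \<mu>_nn: "0 \<le> \<mu> C" if "C \<in> ?K" for C
    unfolding \<mu>_def using that p(1) by (intro prod_nonneg) (auto simp: PiE_def Pi_def)
  have marg: "(\<Sum>C\<in>?K. \<mu> C * h (C i)) = (\<Sum>u\<in>A. p u * h u)" if "i \<in> ?J" for h i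
    unfolding \<mu>_def using sum_PiE_weight_marginal[of ?J "\<lambda>_. A" "\<lambda>_. p"] fin p that by simp
  have marg2: "(\<Sum>C\<in>?K. \<mu> C * h (C i) (C j)) = (\<Sum>a\<in>A. p a * (\<Sum>b\<in>A. p b * h a b))"
    if "i \<in> ?J" "j \<in> ?J" "i \<noteq> j" for h i j
    unfolding \<mu>_def using sum_PiE_weight_marginal2[of ?J "\<lambda>_. A" "\<lambda>_. p"] fin p that by simp
  define miss where "miss u y = (of_bool (S u y < a) :: real)" for u y
  define hit where "hit u y = (of_bool (a \<le> S u y) :: real)" for u y
  have nn: "0 \<le> miss u y" "0 \<le> hit u y" for u y by (auto simp: miss_def hit_def)
  note \<beta>' = \<beta>[folded hit_def]
  let ?X = "\<lambda>u. \<Sum>y\<in>Y. w u y * miss u y"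
  let ?F = "\<lambda>u u'. \<Sum>y\<in>Y. w u y * hit u' y"
  have err: "1 - (\<Sum>y\<in>{y\<in>Y. threshold_decoder Mn L S a C y = m}. w (C (m, l)) y)
      \<le> ?X (C (m, l)) + (\<Sum>j\<in>?J'. ?F (C (m, l)) (C j))" if C: "C \<in> ?K" and l: "l < L" for C l
  proof -
    have CA: "C (m, l) \<in> A" using C l m by auto
    have "1 - (\<Sum>y\<in>{y\<in>Y. threshold_decoder Mn L S a C y = m}. w (C (m, l)) y)
        = (\<Sum>y\<in>Y. w (C (m, l)) y) - (\<Sum>y\<in>Y. w (C (m, l)) y * of_bool (threshold_decoder Mn L S a C y = m))"
      using w(2)[OF CA] fin by (simp add: sum.inter_filter[symmetric] of_bool_def if_distrib cong: if_cong)
    also have "\<dots> = (\<Sum>y\<in>Y. w (C (m, l)) y * of_bool (threshold_decoder Mn L S a C y \<noteq> m))"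
      unfolding sum_subtractf[symmetric] by (intro sum.cong) auto
    also have "\<dots> \<le> (\<Sum>y\<in>Y. w (C (m, l)) y * (miss (C (m, l)) y + (\<Sum>j\<in>?J'. hit (C j) y)))"
    proof (intro sum_mono mult_left_mono)
      fix y assume "y \<in> Y"
      show "of_bool (threshold_decoder Mn L S a C y \<noteq> m)
        \<le> (miss (C (m, l)) y + (\<Sum>j\<in>?J'. hit (C j) y) :: real)"
      proof (cases "threshold_decoder Mn L S a C y = m")
        case False
        from threshold_decoder_error[OF this m l] show ?thesis
        proof
          assume "\<exists>j\<in>?J'. a \<le> S (C j) y"
          then obtain j where j: "j \<in> ?J'" "a \<le> S (C j) y" by blast
          have "hit (C j) y \<le> (\<Sum>j\<in>?J'. hit (C j) y :: real)"
            using j(1) nn by (intro member_le_sum) auto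
          then have "1 \<le> (\<Sum>j\<in>?J'. hit (C j) y)" using j(2) by (simp add: hit_def)
          moreover have "(0::real) \<le> miss (C (m, l)) y" by (rule nn)
          ultimately show ?thesis using False by (simp)
        qed (simp add: sum_nonneg nn miss_def[of "C (m, l)"])
      qed (simp add: sum_nonneg nn)
    qed (use w(1) CA in auto)
    also have "\<dots> = ?X (C (m, l)) + (\<Sum>j\<in>?J'. ?F (C (m, l)) (C j))"
      by (simp add: ring_distribs sum.distrib sum_distrib_left sum.swap[of _ ?J' Y])
    finally show ?thesis .
  qed
  \<comment> \<open>A word of another message is independent of the sent word and thus of the
    output, so \<open>\<beta>\<close> applies for each fixed \<open>y\<close>.\<close>
  have false_cw: "(\<Sum>C\<in>?K. \<mu> C * ?F (C (m, l)) (C j)) \<le> \<beta>" if l: "l < L" and j: "j \<in> ?J'" for l j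
  proof -
    have "(\<Sum>C\<in>?K. \<mu> C * ?F (C (m, l)) (C j)) = (\<Sum>u\<in>A. p u * (\<Sum>u'\<in>A. p u' * ?F u u'))"
      using j l m by (intro marg2) auto
    also have "\<dots> = (\<Sum>u\<in>A. p u * (\<Sum>y\<in>Y. w u y * (\<Sum>u'\<in>A. p u' * hit u' y)))"
      by (simp add: sum_distrib_left sum.swap[of _ Y A] mult.left_commute[of "p _" "w _ _"])
    also have "\<dots> \<le> (\<Sum>u\<in>A. p u * (\<Sum>y\<in>Y. w u y * \<beta>))"
      by (intro sum_mono mult_left_mono p \<beta>' w)
    also have "\<dots> = \<beta>" using p w by (simp add: sum_distrib_right[symmetric])
    finally show ?thesis .
  qed
  have cardJ': "real (card ?J') = (real Mn - 1) * real L"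
    using m by (simp add: card_cartesian_product of_nat_diff)
  have "(\<Sum>C\<in>?K. \<mu> C * (1 - (\<Sum>l<L. \<Sum>y\<in>{y\<in>Y. threshold_decoder Mn L S a C y = m}. w (C (m, l)) y) / real L))
     = (\<Sum>C\<in>?K. \<mu> C * ((\<Sum>l<L. 1 - (\<Sum>y\<in>{y\<in>Y. threshold_decoder Mn L S a C y = m}. w (C (m, l)) y)) / real L))"
    using L by (simp add: sum_subtractf diff_divide_distrib)
  also have "\<dots> \<le> (\<Sum>C\<in>?K. \<mu> C * ((\<Sum>l<L. ?X (C (m, l)) + (\<Sum>j\<in>?J'. ?F (C (m, l)) (C j))) / real L))"
    by (intro sum_mono mult_left_mono divide_right_mono err \<mu>_nn) auto
  also have "\<dots> = (\<Sum>l<L. \<Sum>C\<in>?K. \<mu> C * (?X (C (m, l)) + (\<Sum>j\<in>?J'. ?F (C (m, l)) (C j)))) / real L"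
    by (subst sum.swap) (simp add: sum_divide_distrib sum_distrib_left)
  also have "\<dots> \<le> (\<Sum>l<L. (\<Sum>u\<in>A. p u * ?X u) + (\<Sum>j\<in>?J'. \<beta>)) / real L"
  proof (intro divide_right_mono sum_mono)
    fix l assume "l \<in> {..<L}"
    then have l: "l < L" by simp
    have "(\<Sum>C\<in>?K. \<mu> C * (?X (C (m, l)) + (\<Sum>j\<in>?J'. ?F (C (m, l)) (C j))))
        = (\<Sum>C\<in>?K. \<mu> C * ?X (C (m, l))) + (\<Sum>j\<in>?J'. \<Sum>C\<in>?K. \<mu> C * ?F (C (m, l)) (C j))"
      unfolding ring_distribs sum.distrib sum_distrib_left[of "\<mu> _" _ ?J']
      by (simp only: sum.swap[of _ ?J' ?K])
    also have "\<dots> \<le> (\<Sum>u\<in>A. p u * ?X u) + (\<Sum>j\<in>?J'. \<beta>)"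
      using marg[of "(m, l)" ?X] l m by (intro add_mono sum_mono false_cw) auto
    finally show "(\<Sum>C\<in>?K. \<mu> C * (?X (C (m, l)) + (\<Sum>j\<in>?J'. ?F (C (m, l)) (C j))))
      \<le> (\<Sum>u\<in>A. p u * ?X u) + (\<Sum>j\<in>?J'. \<beta>)" .
  qed simp
  also have "\<dots> = (\<Sum>u\<in>A. p u * ?X u) + (real Mn - 1) * real L * \<beta>"
    using L by (simp only: sum_constant cardJ') simp
  also have "(\<Sum>u\<in>A. p u * ?X u) = (\<Sum>u\<in>A. \<Sum>y\<in>Y. p u * w u y * miss u y)"
    by (simp add: sum_distrib_left mult.assoc)
  finally show ?thesis unfolding \<mu>_def miss_def .
qed

section \<open>A universal decoding score\<close>

text \<open>Mutual information with natural logarithm, in the form of a mean information density;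
  nats suit the exponential bounds.\<close>

definition mi_nats :: "'u set \<Rightarrow> ('u \<Rightarrow> real) \<Rightarrow> ('u \<Rightarrow> 'y::finite \<Rightarrow> real) \<Rightarrow> real" where
  "mi_nats A P w = (\<Sum>u\<in>A. \<Sum>y\<in>UNIV. P u * w u y * ln (w u y / (\<Sum>u'\<in>A. P u' * w u' y)))"

text \<open>Restricted to \<open>A\<close> because a conditional law given \<open>u\<close> is
  normalised only where \<open>u\<close> has positive probability.\<close>

definition stochastic_on :: "'u set \<Rightarrow> ('u \<Rightarrow> 'y::finite \<Rightarrow> real) \<Rightarrow> bool" where
  "stochastic_on A w \<longleftrightarrow> (\<forall>u\<in>A. (\<forall>y. 0 \<le> w u y) \<and> (\<Sum>y\<in>UNIV. w u y) = 1)"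

definition noisy :: "real \<Rightarrow> ('u \<Rightarrow> 'y::finite \<Rightarrow> real) \<Rightarrow> 'u \<Rightarrow> 'y \<Rightarrow> real" where
  "noisy \<eta> w u y = (1 - \<eta>) * w u y + \<eta> / real CARD('y)"

lemma stochastic_on_le_1: "stochastic_on A w \<Longrightarrow> u \<in> A \<Longrightarrow> w u y \<le> 1"
  using member_le_sum[of y UNIV "w u"] by (auto simp: stochastic_on_def)

lemma stochastic_on_noisy:
  "stochastic_on A w \<Longrightarrow> 0 \<le> \<eta> \<Longrightarrow> \<eta> \<le> 1 \<Longrightarrow> stochastic_on A (noisy \<eta> w)"
  by (auto simp: stochastic_on_def noisy_def sum.distrib sum_distrib_left[symmetric])

text \<open>Reduces continuity of the information in the channel to continuity of the single
  function \<open>x * ln x\<close>.\<close>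

lemma mi_nats_eq_entropies:
  fixes w :: "'u \<Rightarrow> 'y::finite \<Rightarrow> real"
  assumes "finite A" "\<And>u. u \<in> A \<Longrightarrow> 0 \<le> P u" "stochastic_on A w"
  shows "mi_nats A P w = (\<Sum>u\<in>A. \<Sum>y\<in>UNIV. P u * (w u y * ln (w u y)))
       - (\<Sum>y\<in>UNIV. (\<Sum>u\<in>A. P u * w u y) * ln (\<Sum>u\<in>A. P u * w u y))"
proof -
  define Q where "Q y = (\<Sum>u\<in>A. P u * w u y)" for y
  have "P u * w u y * ln (w u y / Q y) = P u * (w u y * ln (w u y)) - P u * w u y * ln (Q y)"
    if u: "u \<in> A" for u y
  proof (cases "P u * w u y = 0")
    case False
    have "P u * w u y \<le> Q y"
      unfolding Q_def by (rule member_le_sum) (use assms u in \<open>auto simp: stochastic_on_def\<close>)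
    moreover have "0 \<le> P u * w u y" using assms u by (auto simp: stochastic_on_def)
    ultimately have "Q y \<noteq> 0" "w u y \<noteq> 0" using False by auto
    then show ?thesis by (simp add: ln_div algebra_simps)
  qed auto
  then have "mi_nats A P w = (\<Sum>u\<in>A. \<Sum>y\<in>UNIV. P u * (w u y * ln (w u y)) - P u * w u y * ln (Q y))"
    unfolding mi_nats_def Q_def[symmetric] by (intro sum.cong refl) auto
  also have "\<dots> = (\<Sum>u\<in>A. \<Sum>y\<in>UNIV. P u * (w u y * ln (w u y))) - (\<Sum>y\<in>UNIV. Q y * ln (Q y))"
    unfolding sum_subtractf sum.swap[of _ UNIV A] by (simp add: Q_def sum_distrib_right)
  finally show ?thesis unfolding Q_def .
qed

section \<open>Stability of mutual information under uniform noise\<close>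

lemma continuous_on_x_ln_x: "continuous_on {0..1} (\<lambda>x::real. x * ln x)"
proof (unfold continuous_on_eq_continuous_within, intro ballI)
  fix x :: real assume x: "x \<in> {0..1}"
  show "continuous (at x within {0..1}) (\<lambda>x. x * ln x)"
  proof (cases "x = 0")
    case False
    then show ?thesis by (intro continuous_intros) auto
  next
    case True
    \<comment> \<open>From \<open>ln s \<le> s - 1\<close> at \<open>s = 1 / sqrt y\<close>, a
      majorant that visibly tends to 0.\<close>
    have "\<bar>y * ln y\<bar> \<le> 2 * sqrt y" if "0 \<le> y" "y \<le> 1" for y :: real
    proof (cases "y = 0")
      case False
      then have y: "0 < y" using that by simp
      have "- ln y = 2 * ln (1 / sqrt y)" using y by (simp add: ln_div ln_sqrt)
      also have "\<dots> \<le> 2 * (1 / sqrt y)" using ln_le_minus_one[of "1 / sqrt y"] y by simp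
      finally have "y * (- ln y) \<le> y * (2 * (1 / sqrt y))" using y by (intro mult_left_mono) auto
      also have "\<dots> = 2 * (y / sqrt y)" by simp
      also have "y / sqrt y = sqrt y" using y by (simp add: real_div_sqrt)
      finally show ?thesis using y that by (simp add: abs_mult)
    qed simp
    then have "\<forall>\<^sub>F y in at 0 within {0..1}. norm (y * ln y) \<le> 2 * sqrt y"
      by (auto simp: eventually_at_filter intro!: always_eventually)
    moreover have "((\<lambda>y. 2 * sqrt y) \<longlongrightarrow> 0) (at 0 within {0..1})"
      by (auto intro!: tendsto_eq_intros)
    ultimately have "((\<lambda>y::real. y * ln y) \<longlongrightarrow> 0) (at 0 within {0..1})"
      by (rule Lim_null_comparison)
    then show ?thesis using True by (simp add: continuous_within)
  qed
qed

text \<open>One \<open>\<eta>\<close> serves all channels: noise moves each entry by at most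
  \<open>\<eta>\<close>, and \<open>x * ln x\<close> is uniformly continuous on the unit interval.
  Both entropy sums have total weight \<open>n\<close>, so an error
  \<open>\<delta> / (2 * n)\<close> per entry gives \<open>\<delta>\<close> in all.\<close>

lemma noisy_mi_nats:
  assumes "finite A" "\<And>u. u \<in> A \<Longrightarrow> 0 \<le> P u" "(\<Sum>u\<in>A. P u) = 1" "0 < \<delta>"
  shows "\<exists>\<eta>. 0 < \<eta> \<and> \<eta> \<le> 1 / 2 \<and>
    (\<forall>w :: 'u \<Rightarrow> 'y::finite \<Rightarrow> real. stochastic_on A w \<longrightarrow> mi_nats A P w - \<delta> \<le> mi_nats A P (noisy \<eta> w))"
proof -
  define f where "f x = x * ln x" for x :: real
  define n where "n = real CARD('y)"
  have n: "1 \<le> n" unfolding n_def by (simp add: Suc_leI)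
  have "uniformly_continuous_on {0..1} f"
    unfolding f_def by (intro compact_uniformly_continuous continuous_on_x_ln_x) auto
  then have "\<exists>d>0. \<forall>x\<in>{0..1}. \<forall>x'\<in>{0..1}. dist x' x < d \<longrightarrow> dist (f x') (f x) < \<delta> / (2 * n)"
    using assms(4) n unfolding uniformly_continuous_on_def by auto
  then obtain d where d: "0 < d" "\<And>x y. 0 \<le> x \<Longrightarrow> x \<le> 1 \<Longrightarrow> 0 \<le> y \<Longrightarrow> y \<le> 1 \<Longrightarrow> \<bar>y - x\<bar> < d
      \<Longrightarrow> \<bar>f y - f x\<bar> < \<delta> / (2 * n)"
    by (auto simp: dist_real_def)
  \<comment> \<open>\<open>d / 2\<close> keeps entries closer than \<open>d\<close>; the cap
    \<open>1 / 2\<close> serves the users of the lemma, who divide by \<open>1 - \<eta>\<close> in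
    effect.\<close>
  define \<eta> where "\<eta> = min (1 / 2) (d / 2)"
  have \<eta>: "0 < \<eta>" "\<eta> \<le> 1 / 2" "\<eta> < d" using d by (auto simp: \<eta>_def)
  have close: "\<bar>f ((1 - \<eta>) * x + \<eta> / n) - f x\<bar> < \<delta> / (2 * n)" if x: "0 \<le> x" "x \<le> 1" for x
  proof (rule d(2)[OF x])
    have n1: "0 \<le> 1 / n" "1 / n \<le> 1" using n by auto
    have eq: "(1 - \<eta>) * x + \<eta> / n = x + \<eta> * (1 / n - x)" by (simp add: algebra_simps)
    show "0 \<le> (1 - \<eta>) * x + \<eta> / n" using \<eta> x n by simp
    have "(1 - \<eta>) * x + \<eta> * (1 / n) \<le> (1 - \<eta>) * 1 + \<eta> * 1"
      using \<eta> x n1 by (intro add_mono mult_left_mono) auto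
    then show "(1 - \<eta>) * x + \<eta> / n \<le> 1" by simp
    have "\<bar>1 / n - x\<bar> \<le> 1" using x n1 by linarith
    then have "\<bar>\<eta> * (1 / n - x)\<bar> \<le> \<eta> * 1"
      unfolding abs_mult using \<eta> by (intro mult_mono) auto
    then show "\<bar>(1 - \<eta>) * x + \<eta> / n - x\<bar> < d" using \<eta> unfolding eq by simp
  qed
  have "mi_nats A P w - \<delta> \<le> mi_nats A P (noisy \<eta> w)" if w: "stochastic_on A w" for w :: "'u \<Rightarrow> 'y \<Rightarrow> real"
  proof -
    define Q where "Q y = (\<Sum>u\<in>A. P u * w u y)" for y
    have Q0: "0 \<le> Q y" for y unfolding Q_def using assms w by (intro sum_nonneg) (auto simp: stochastic_on_def)
    have Q1: "Q y \<le> 1" for y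
    proof -
      have "Q y \<le> (\<Sum>u\<in>A. P u * 1)"
        unfolding Q_def by (intro sum_mono mult_left_mono stochastic_on_le_1[OF w] assms)
      then show ?thesis using assms by simp
    qed
    have Qn: "(\<Sum>u\<in>A. P u * noisy \<eta> w u y) = (1 - \<eta>) * Q y + \<eta> / n" for y
    proof -
      have "(\<Sum>u\<in>A. P u * noisy \<eta> w u y) = (\<Sum>u\<in>A. (1 - \<eta>) * (P u * w u y) + P u * (\<eta> / n))"
        unfolding noisy_def n_def by (intro sum.cong) (auto simp: algebra_simps)
      also have "\<dots> = (1 - \<eta>) * Q y + (\<Sum>u\<in>A. P u) * (\<eta> / n)"
        unfolding Q_def sum.distrib sum_distrib_left sum_distrib_right ..
      finally show ?thesis using assms by simp
    qed
    have n_eq: "noisy \<eta> w u y = (1 - \<eta>) * w u y + \<eta> / n" for u y by (simp add: noisy_def n_def)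
    have 1: "mi_nats A P w = (\<Sum>u\<in>A. \<Sum>y\<in>UNIV. P u * f (w u y)) - (\<Sum>y\<in>UNIV. f (Q y))"
      unfolding f_def Q_def using assms w by (intro mi_nats_eq_entropies) auto
    have 2: "mi_nats A P (noisy \<eta> w) = (\<Sum>u\<in>A. \<Sum>y\<in>UNIV. P u * f (noisy \<eta> w u y))
        - (\<Sum>y\<in>UNIV. f ((1 - \<eta>) * Q y + \<eta> / n))"
      unfolding Qn[symmetric] f_def using assms w \<eta> by (intro mi_nats_eq_entropies stochastic_on_noisy) auto
    have "(\<Sum>u\<in>A. \<Sum>y\<in>(UNIV::'y set). P u * f (w u y)) \<le> (\<Sum>u\<in>A. \<Sum>y\<in>(UNIV::'y set). P u * (f (noisy \<eta> w u y) + \<delta> / (2 * n)))"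
    proof (intro sum_mono mult_left_mono assms)
      fix u y assume u: "u \<in> A"
      have "0 \<le> w u y" using w u by (auto simp: stochastic_on_def)
      then show "f (w u y) \<le> f (noisy \<eta> w u y) + \<delta> / (2 * n)"
        using close[of "w u y"] stochastic_on_le_1[OF w u] unfolding n_eq by (smt (verit))
    qed
    also have "\<dots> = (\<Sum>u\<in>A. \<Sum>y\<in>(UNIV::'y set). P u * f (noisy \<eta> w u y)) + (\<Sum>u\<in>A. P u) * (n * (\<delta> / (2 * n)))"
    proof -
      have "(\<Sum>y\<in>(UNIV::'y set). P u * (f (noisy \<eta> w u y) + c))
          = (\<Sum>y\<in>(UNIV::'y set). P u * f (noisy \<eta> w u y)) + P u * (n * c)" for u c
        by (simp add: ring_distribs sum.distrib n_def)
      then show ?thesis by (simp only: sum.distrib sum_distrib_right)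
    qed
    finally have 3: "(\<Sum>u\<in>A. \<Sum>y\<in>(UNIV::'y set). P u * f (w u y))
        \<le> (\<Sum>u\<in>A. \<Sum>y\<in>(UNIV::'y set). P u * f (noisy \<eta> w u y)) + \<delta> / 2"
      using n assms by simp
    have "(\<Sum>y\<in>UNIV. f ((1 - \<eta>) * Q y + \<eta> / n)) \<le> (\<Sum>y\<in>UNIV. f (Q y) + \<delta> / (2 * n))"
    proof (intro sum_mono)
      fix y show "f ((1 - \<eta>) * Q y + \<eta> / n) \<le> f (Q y) + \<delta> / (2 * n)"
        using close[OF Q0 Q1, of y] by linarith
    qed
    also have "\<dots> = (\<Sum>y\<in>UNIV. f (Q y)) + n * (\<delta> / (2 * n))" by (simp add: sum.distrib n_def)
    also have "n * (\<delta> / (2 * n)) = \<delta> / 2" using n by simp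
    finally show ?thesis unfolding 1 2 using 3 by linarith
  qed
  then show ?thesis using \<eta> by blast
qed

text \<open>An approximate minimiser replaces a compactness argument, and mixing the channels with uniform
  noise keeps the information density finite.\<close>

lemma universal_score_exists:
  fixes \<W> :: "('u \<Rightarrow> 'y::finite \<Rightarrow> real) set"
  assumes fin: "finite A" and P: "\<And>u. u \<in> A \<Longrightarrow> 0 \<le> P u" "(\<Sum>u\<in>A. P u) = 1"
    and st: "\<And>w. w \<in> \<W> \<Longrightarrow> stochastic_on A w" and ne: "\<W> \<noteq> {}"
    and cvx: "\<And>w w' t. w \<in> \<W> \<Longrightarrow> w' \<in> \<W> \<Longrightarrow> 0 \<le> t \<Longrightarrow> t \<le> 1
                \<Longrightarrow> (\<lambda>u y. (1 - t) * w u y + t * w' u y) \<in> \<W>"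
    and I: "0 \<le> I" "\<And>w. w \<in> \<W> \<Longrightarrow> I \<le> mi_nats A P w" and \<delta>: "0 < \<delta>"
  obtains \<theta> where "\<And>y. (\<Sum>u\<in>A. P u * exp (\<theta> u y)) \<le> 1"
    and "\<And>w. w \<in> \<W> \<Longrightarrow> I - \<delta> \<le> (\<Sum>u\<in>A. \<Sum>y\<in>UNIV. P u * w u y * \<theta> u y)"
proof -
  define n where "n = real CARD('y)"
  have n: "1 \<le> n" unfolding n_def by (simp add: Suc_leI)
  obtain \<eta> where \<eta>: "0 < \<eta>" "\<eta> \<le> 1 / 2"
    and mi_noisy: "\<And>w :: 'u \<Rightarrow> 'y \<Rightarrow> real. stochastic_on A w \<Longrightarrow> mi_nats A P w - \<delta> / 4 \<le> mi_nats A P (noisy \<eta> w)"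
    using noisy_mi_nats[of A P "\<delta> / 4"] fin P \<delta> by auto
  define F where "F w = mi_nats A P (noisy \<eta> w)" for w :: "'u \<Rightarrow> 'y \<Rightarrow> real"
  have F_ge: "I - \<delta> / 4 \<le> F w" if "w \<in> \<W>" for w
    using mi_noisy[OF st[OF that]] I(2)[OF that] unfolding F_def by linarith
  \<comment> \<open>Bounds the second-order remainder: \<open>(\<Delta> u y)\<^sup>2 / b u y\<close>
    is at most \<open>n / \<eta>\<close>, and \<open>y\<close> ranges over \<open>n\<close>
    letters.\<close>
  define K where "K = n * n / \<eta>"
  have Kp: "0 < K" unfolding K_def using n \<eta> by simp
  \<comment> \<open>Step length of the finite difference. The remainder is then at most
    \<open>t * \<delta> / 8\<close>, and \<open>w0\<close> is taken minimal up to the same amount,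
    so both errors stay small after division by \<open>t\<close>.\<close>
  define t where "t = min 1 (\<delta> / (8 * K))"
  have t: "0 < t" "t \<le> 1" using \<delta> Kp by (auto simp: t_def)
  have "t * (8 * K) \<le> \<delta>" using Kp by (simp add: t_def min_def field_simps)
  then have tK: "t * K \<le> \<delta> / 8" by simp
  have bdd: "bdd_below (F ` \<W>)" using F_ge by (intro bdd_belowI[of _ "I - \<delta> / 4"]) auto
  have "Inf (F ` \<W>) < Inf (F ` \<W>) + t * \<delta> / 8" using t \<delta> by simp
  then obtain w0 where w0: "w0 \<in> \<W>" "F w0 < Inf (F ` \<W>) + t * \<delta> / 8"
    using cInf_lessD[of "F ` \<W>"] ne by blast
  define b where "b = noisy \<eta> w0"
  define Q where "Q y = (\<Sum>u\<in>A. P u * b u y)" for y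
  define \<theta> where "\<theta> u y = ln (b u y / Q y)" for u y
  have noisy_ge: "\<eta> / n \<le> noisy \<eta> w u y" if "w \<in> \<W>" "u \<in> A" for w u y
    using st[OF that(1)] that(2) \<eta> by (auto simp: noisy_def n_def stochastic_on_def)
  have \<eta>n: "0 < \<eta> / n" using \<eta> n by simp
  have noisy_p: "0 < noisy \<eta> w u y" if "w \<in> \<W>" "u \<in> A" for w u y
    using noisy_ge[OF that] \<eta>n by (meson less_le_trans)
  have noisy_st: "stochastic_on A (noisy \<eta> w)" if "w \<in> \<W>" for w
    using st[OF that] \<eta> by (intro stochastic_on_noisy) auto
  have Qge: "\<eta> / n \<le> (\<Sum>u\<in>A. P u * noisy \<eta> w u y)" if "w \<in> \<W>" for w y
  proof -
    have "(\<Sum>u\<in>A. P u * (\<eta> / n)) \<le> (\<Sum>u\<in>A. P u * noisy \<eta> w u y)"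
      by (intro sum_mono mult_left_mono noisy_ge that P)
    then show ?thesis using P by (simp add: sum_distrib_right[symmetric] sum_divide_distrib[symmetric])
  qed
  have Qp: "0 < Q y" for y using Qge[OF w0(1), of y] \<eta>n unfolding Q_def b_def by linarith
  have bp: "0 < b u y" if "u \<in> A" for u y unfolding b_def by (rule noisy_p[OF w0(1) that])
  have sum1: "(\<Sum>u\<in>A. P u * (b u y / Q y)) = 1" for y
    using Qp[of y] by (simp add: Q_def[symmetric] sum_divide_distrib[symmetric])
  have fact1: "(\<Sum>u\<in>A. P u * exp (\<theta> u y)) = 1" for y
    unfolding sum1[of y, symmetric] \<theta>_def using bp Qp by (intro sum.cong refl) simp
  have fact2: "(\<Sum>u\<in>A. P u * \<theta> u y) \<le> 0" for y
  proof -
    have "(\<Sum>u\<in>A. P u * \<theta> u y) \<le> (\<Sum>u\<in>A. P u * (b u y / Q y - 1))"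
      unfolding \<theta>_def using bp Qp P by (intro sum_mono mult_left_mono ln_le_minus_one) auto
    also have "\<dots> = 0" using sum1[of y] P by (simp add: right_diff_distrib sum_subtractf)
    finally show ?thesis .
  qed
  have "I - \<delta> \<le> (\<Sum>u\<in>A. \<Sum>y\<in>UNIV. P u * w u y * \<theta> u y)" if w: "w \<in> \<W>" for w
  proof -
    define \<Delta> where "\<Delta> u y = noisy \<eta> w u y - b u y" for u y
    define v where "v u y = b u y + t * \<Delta> u y" for u y
    define wt where "wt = (\<lambda>u y. (1 - t) * w0 u y + t * w u y)"
    \<comment> \<open>The directional derivative of the information at \<open>b\<close> towards
      \<open>noisy \<eta> w\<close>; the output law contributes nothing to it, since it stays
      normalised.\<close>
    define D where "D = (\<Sum>u\<in>A. \<Sum>y\<in>UNIV. P u * \<Delta> u y * \<theta> u y)"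
    have wt: "wt \<in> \<W>" unfolding wt_def using cvx w0 w t by auto
    have v_eq: "noisy \<eta> wt = v"
      by (intro ext) (simp add: noisy_def wt_def v_def \<Delta>_def b_def algebra_simps)
    define R where "R y = (\<Sum>u\<in>A. P u * v u y)" for y
    have Rp: "0 < R y" for y using Qge[OF wt, of y] \<eta>n unfolding R_def v_eq by linarith
    have vp: "0 < v u y" if "u \<in> A" for u y using noisy_p[OF wt that] unfolding v_eq .
    have v_st: "stochastic_on A v" using noisy_st[OF wt] unfolding v_eq .
    have b_st: "stochastic_on A b" using noisy_st[OF w0(1)] unfolding b_def .
    have sumQR: "(\<Sum>y\<in>UNIV. Q y) = 1" "(\<Sum>y\<in>UNIV. R y) = 1"
      unfolding Q_def R_def sum.swap[of _ A UNIV] sum_distrib_left[symmetric]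
      using v_st b_st P by (simp_all add: stochastic_on_def)
    have sum\<Delta>: "(\<Sum>y\<in>UNIV. \<Delta> u y) = 0" if "u \<in> A" for u
      using noisy_st[OF w] b_st that by (simp add: \<Delta>_def sum_subtractf stochastic_on_def)
    have \<Delta>1: "(\<Delta> u y)\<^sup>2 \<le> 1" if u: "u \<in> A" for u y
    proof -
      have "\<bar>\<Delta> u y\<bar> \<le> 1"
        using noisy_p[OF w u, of y] bp[OF u, of y] stochastic_on_le_1[OF noisy_st[OF w] u, of y]
          stochastic_on_le_1[OF b_st u, of y] unfolding \<Delta>_def by linarith
      then show ?thesis by (simp add: abs_square_le_1)
    qed
    \<comment> \<open>Both \<open>ln (v u y / b u y)\<close> and \<open>ln (Q y / R y)\<close> are
      bounded by \<open>x - 1\<close>. In the sum the term linear in \<open>\<Delta>\<close>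
      vanishes because its rows sum to 0, and the last term vanishes because \<open>Q\<close> and
      \<open>R\<close> have equal mass.\<close>
    have tangent: "P u * v u y * ln (v u y / R y)
        \<le> P u * v u y * \<theta> u y + t * (P u * \<Delta> u y) + t\<^sup>2 * (P u * (n / \<eta>)) + P u * v u y * (Q y / R y - 1)"
      if u: "u \<in> A" for u y
    proof -
      have "ln (v u y / R y) = \<theta> u y + ln (v u y / b u y) + ln (Q y / R y)"
        unfolding \<theta>_def using vp[OF u, of y] bp[OF u, of y] Qp[of y] Rp[of y] by (simp add: ln_divide_pos)
      also have "\<dots> \<le> \<theta> u y + (v u y / b u y - 1) + (Q y / R y - 1)"
        using vp[OF u, of y] bp[OF u, of y] Qp[of y] Rp[of y] by (intro add_mono ln_le_minus_one) auto
      also have "v u y / b u y - 1 = t * \<Delta> u y / b u y"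
        unfolding v_def using bp[OF u, of y] by (simp add: field_simps)
      finally have "P u * v u y * ln (v u y / R y)
          \<le> P u * v u y * (\<theta> u y + t * \<Delta> u y / b u y + (Q y / R y - 1))"
        using vp[OF u, of y] P(1)[OF u] by (intro mult_left_mono) auto
      also have "\<dots> = P u * v u y * \<theta> u y + P u * (v u y * (t * \<Delta> u y / b u y)) + P u * v u y * (Q y / R y - 1)"
        by (simp add: algebra_simps)
      also have "v u y * (t * \<Delta> u y / b u y) = t * \<Delta> u y + t\<^sup>2 * ((\<Delta> u y)\<^sup>2 / b u y)"
        unfolding v_def using bp[OF u, of y] by (simp add: field_simps power2_eq_square)
      also have "P u * (t * \<Delta> u y + t\<^sup>2 * ((\<Delta> u y)\<^sup>2 / b u y)) \<le> P u * (t * \<Delta> u y + t\<^sup>2 * (n / \<eta>))"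
      proof (intro mult_left_mono add_left_mono P(1) u)
        have "(\<Delta> u y)\<^sup>2 / b u y \<le> 1 / (\<eta> / n)"
          using \<Delta>1[OF u, of y] noisy_ge[OF w0(1) u, of y] \<eta>n unfolding b_def by (intro frac_le) auto
        then show "(\<Delta> u y)\<^sup>2 / b u y \<le> n / \<eta>" by simp
      qed auto
      finally show ?thesis by (simp add: algebra_simps)
    qed
    have "F wt = (\<Sum>u\<in>A. \<Sum>y\<in>UNIV. P u * v u y * ln (v u y / R y))"
      unfolding F_def v_eq mi_nats_def R_def ..
    also have "\<dots> \<le> (\<Sum>u\<in>A. \<Sum>y\<in>UNIV. P u * v u y * \<theta> u y + t * (P u * \<Delta> u y)
        + t\<^sup>2 * (P u * (n / \<eta>)) + P u * v u y * (Q y / R y - 1))"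
      by (intro sum_mono tangent)
    also have "\<dots> = (\<Sum>u\<in>A. \<Sum>y\<in>UNIV. P u * v u y * \<theta> u y) + (\<Sum>u\<in>A. \<Sum>y\<in>UNIV. t * (P u * \<Delta> u y))
        + (\<Sum>u\<in>A. \<Sum>y\<in>(UNIV::'y set). t\<^sup>2 * (P u * (n / \<eta>))) + (\<Sum>u\<in>A. \<Sum>y\<in>UNIV. P u * v u y * (Q y / R y - 1))"
      by (simp only: sum.distrib)
    also have "(\<Sum>u\<in>A. \<Sum>y\<in>UNIV. t * (P u * \<Delta> u y)) = 0"
      unfolding sum_distrib_left[symmetric] using sum\<Delta> by simp
    also have "(\<Sum>u\<in>A. \<Sum>y\<in>(UNIV::'y set). t\<^sup>2 * (P u * (n / \<eta>))) = t\<^sup>2 * K"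
    proof -
      have "(\<Sum>u\<in>A. \<Sum>y\<in>(UNIV::'y set). t\<^sup>2 * (P u * (n / \<eta>))) = (\<Sum>u\<in>A. P u) * (t\<^sup>2 * K)"
        unfolding sum_distrib_right by (intro sum.cong) (simp_all add: n_def K_def)
      then show ?thesis using P by simp
    qed
    also have "(\<Sum>u\<in>A. \<Sum>y\<in>UNIV. P u * v u y * (Q y / R y - 1)) = 0"
    proof -
      have "(\<Sum>u\<in>A. \<Sum>y\<in>UNIV. P u * v u y * (Q y / R y - 1)) = (\<Sum>y\<in>UNIV. R y * (Q y / R y - 1))"
        by (subst sum.swap) (simp add: R_def sum_distrib_right)
      also have "\<dots> = (\<Sum>y\<in>UNIV. Q y - R y)"
        by (intro sum.cong refl) (use Rp in \<open>simp add: right_diff_distrib less_imp_neq[THEN not_sym]\<close>)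
      also have "\<dots> = 0" using sumQR by (simp add: sum_subtractf)
      finally show ?thesis .
    qed
    also have "(\<Sum>u\<in>A. \<Sum>y\<in>UNIV. P u * v u y * \<theta> u y) = F w0 + t * D"
      unfolding F_def mi_nats_def b_def[symmetric] Q_def[symmetric] \<theta>_def[symmetric] D_def v_def
      by (simp add: algebra_simps sum.distrib sum_distrib_left)
    finally have "F wt \<le> F w0 + t * D + t\<^sup>2 * K" by simp
    moreover have "Inf (F ` \<W>) \<le> F wt" using bdd wt by (intro cInf_lower) auto
    ultimately have "- (t * \<delta> / 8) \<le> t * D + t\<^sup>2 * K" using w0(2) by linarith
    then have "t * (- (\<delta> / 8)) \<le> t * (D + t * K)" by (simp add: algebra_simps power2_eq_square)
    then have "- (\<delta> / 8) \<le> D + t * K" using mult_le_cancel_left_pos[OF t(1)] by blast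
    then have D: "- (\<delta> / 4) \<le> D" using tK by linarith
    define E where "E = (\<Sum>u\<in>A. \<Sum>y\<in>UNIV. P u * w u y * \<theta> u y)"
    \<comment> \<open>\<open>F w0\<close> is the mean of \<open>\<theta>\<close> under
      \<open>b\<close> itself, so adding \<open>D\<close> moves the mean to
      \<open>noisy \<eta> w\<close>.\<close>
    have "F w0 + D = (\<Sum>u\<in>A. \<Sum>y\<in>UNIV. P u * noisy \<eta> w u y * \<theta> u y)"
      unfolding F_def mi_nats_def b_def[symmetric] Q_def[symmetric] \<theta>_def[symmetric] D_def \<Delta>_def
      by (simp add: algebra_simps sum.distrib sum_subtractf)
    also have "\<dots> = (1 - \<eta>) * E + \<eta> / n * (\<Sum>y\<in>UNIV. \<Sum>u\<in>A. P u * \<theta> u y)"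
      unfolding E_def noisy_def n_def[symmetric] sum.swap[of _ A UNIV]
      by (simp add: ring_distribs sum.distrib sum_distrib_left mult_ac)
    also have "\<eta> / n * (\<Sum>y\<in>UNIV. \<Sum>u\<in>A. P u * \<theta> u y) \<le> 0"
      by (rule mult_nonneg_nonpos[OF _ sum_nonpos]) (use \<eta>n fact2 in auto)
    finally have "I - \<delta> / 2 \<le> (1 - \<eta>) * E" using D F_ge[OF w0(1)] by linarith
    \<comment> \<open>The factor \<open>1 - \<eta>\<close> lies between \<open>1 / 2\<close> and 1.
      For \<open>E \<ge> 0\<close> it only helps; for \<open>E < 0\<close> it gives
      \<open>2 * I - \<delta> \<le> E\<close>, and \<open>0 \<le> I\<close> concludes.\<close>
    then show ?thesis
    proof (cases "0 \<le> E")
      case True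
      then have "(1 - \<eta>) * E \<le> 1 * E" using \<eta> by (intro mult_right_mono) auto
      then show ?thesis using \<open>I - \<delta> / 2 \<le> (1 - \<eta>) * E\<close> \<delta> unfolding E_def by linarith
    next
      case False
      then have "(1 - \<eta>) * E \<le> 1 / 2 * E" using \<eta> by (intro mult_right_mono_neg) auto
      then show ?thesis using \<open>I - \<delta> / 2 \<le> (1 - \<eta>) * E\<close> I(1) \<delta> unfolding E_def by linarith
    qed
  qed
  then show thesis using that[of \<theta>] fact1 by simp
qed

section \<open>Exponential bounds\<close>

text \<open>Needed for both signs: missed words use a negative exponent, soft covering a positive
  one. For \<open>x = - y\<close> the claim follows by multiplying a lower bound of
  \<open>exp y\<close> by \<open>1 - y + y\<^sup>2\<close>.\<close>

lemma exp_le_quadratic: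
  fixes x :: real
  assumes "\<bar>x\<bar> \<le> 1"
  shows "exp x \<le> 1 + x + x\<^sup>2"
proof (cases "0 \<le> x")
  case False
  define y where "y = - x"
  have y: "0 < y" "y \<le> 1" using False assms by (auto simp: y_def)
  have *: "1 + y + y\<^sup>2 / 2 \<le> exp y" using exp_lower_Taylor_quadratic[of y] y by simp
  have "1 \<le> (1 - y + y\<^sup>2) * (1 + y + y\<^sup>2 / 2)"
  proof -
    have "(1 - y + y\<^sup>2) * (1 + y + y\<^sup>2 / 2) = 1 + y\<^sup>2 / 2 + y ^ 3 / 2 + y ^ 4 / 2"
      by (simp add: field_simps power2_eq_square power3_eq_cube power4_eq_xxxx)
    then show ?thesis using y by simp
  qed
  also have "\<dots> \<le> (1 - y + y\<^sup>2) * exp y"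
    using * y by (intro mult_left_mono) auto
  finally have "exp (- y) \<le> 1 - y + y\<^sup>2" by (simp add: exp_minus field_simps)
  then show ?thesis by (simp add: y_def)
qed (use exp_bound assms in auto)

text \<open>A power, unlike \<open>ln (1 + x)\<close>, factors over letters. For
  \<open>x \<le> 1\<close> use \<open>ln (1 + x) \<le> x\<close>; otherwise bound \<open>ln\<close>
  of \<open>(1 + x) powr \<rho>\<close> and then \<open>1 + x\<close> by
  \<open>2 * x\<close>.\<close>

lemma ln_one_plus_le_powr:
  fixes x \<rho> :: real
  assumes "0 \<le> x" "0 < \<rho>" "\<rho> \<le> 1"
  shows "ln (1 + x) \<le> 2 * x powr \<rho> / \<rho>"
proof (cases "x \<le> 1")
  case True
  have "ln (1 + x) \<le> x powr 1" using assms ln_add_one_self_le_self[of x] by simp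
  also have "\<dots> \<le> x powr \<rho>" using assms True by (intro powr_mono') auto
  also have "\<dots> \<le> 2 * x powr \<rho> / \<rho>"
  proof -
    have "\<rho> * x powr \<rho> \<le> 2 * x powr \<rho>" using assms by (intro mult_right_mono) auto
    then show ?thesis using assms by (simp add: field_simps)
  qed
  finally show ?thesis .
next
  case False
  have "\<rho> * ln (1 + x) = ln ((1 + x) powr \<rho>)" using assms by (simp add: ln_powr)
  also have "\<dots> \<le> (1 + x) powr \<rho>"
    using ln_le_minus_one[of "(1 + x) powr \<rho>"] assms by simp
  also have "\<dots> \<le> (2 * x) powr \<rho>" using assms False by (intro powr_mono2) auto
  also have "\<dots> = 2 powr \<rho> * x powr \<rho>" using assms by (simp add: powr_mult)
  also have "\<dots> \<le> 2 * x powr \<rho>"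
    using assms powr_mono[of \<rho> 1 "2::real"] by (intro mult_right_mono) auto
  finally show ?thesis using assms by (simp add: field_simps)
qed

text \<open>The law enters only through the mean of \<open>g\<close>, the remainder being uniform.
  Products over positions with different channels therefore collapse to a sum of means.\<close>

lemma sum_exp_moment_le:
  fixes w :: "'a \<Rightarrow> 'b \<Rightarrow> real"
  assumes "\<And>a b. a \<in> A \<Longrightarrow> b \<in> B \<Longrightarrow> 0 \<le> w a b" "(\<Sum>a\<in>A. \<Sum>b\<in>B. w a b) = 1"
    and "\<And>a b. a \<in> A \<Longrightarrow> b \<in> B \<Longrightarrow> \<bar>g a b\<bar> \<le> Bd" and "\<bar>\<rho>\<bar> * Bd \<le> 1"
  shows "(\<Sum>a\<in>A. \<Sum>b\<in>B. w a b * exp (\<rho> * g a b))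
       \<le> exp (\<rho> * (\<Sum>a\<in>A. \<Sum>b\<in>B. w a b * g a b) + \<rho>\<^sup>2 * Bd\<^sup>2)"
proof -
  have "exp (\<rho> * g a b) \<le> 1 + \<rho> * g a b + \<rho>\<^sup>2 * Bd\<^sup>2" if "a \<in> A" "b \<in> B" for a b
  proof -
    have 1: "\<bar>\<rho> * g a b\<bar> \<le> \<bar>\<rho>\<bar> * Bd"
      unfolding abs_mult by (intro mult_left_mono assms that) auto
    then have "exp (\<rho> * g a b) \<le> 1 + \<rho> * g a b + (\<rho> * g a b)\<^sup>2"
      using assms by (intro exp_le_quadratic) auto
    moreover have "(\<rho> * g a b)\<^sup>2 \<le> (\<bar>\<rho>\<bar> * Bd)\<^sup>2" by (rule abs_le_square_iff[THEN iffD1])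
      (use 1 abs_ge_self[of "\<bar>\<rho>\<bar> * Bd"] in linarith)
    ultimately show ?thesis by (simp add: power_mult_distrib)
  qed
  then have "(\<Sum>a\<in>A. \<Sum>b\<in>B. w a b * exp (\<rho> * g a b))
      \<le> (\<Sum>a\<in>A. \<Sum>b\<in>B. w a b * (1 + \<rho> * g a b + \<rho>\<^sup>2 * Bd\<^sup>2))"
    by (intro sum_mono mult_left_mono assms)
  also have "\<dots> = (\<Sum>a\<in>A. \<Sum>b\<in>B. w a b) + \<rho> * (\<Sum>a\<in>A. \<Sum>b\<in>B. w a b * g a b)
      + \<rho>\<^sup>2 * Bd\<^sup>2 * (\<Sum>a\<in>A. \<Sum>b\<in>B. w a b)"
    by (simp add: ring_distribs sum.distrib sum_distrib_left sum_distrib_right mult_ac)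
  also have "\<dots> \<le> exp (\<rho> * (\<Sum>a\<in>A. \<Sum>b\<in>B. w a b * g a b) + \<rho>\<^sup>2 * Bd\<^sup>2)"
    unfolding assms(2)
    using exp_ge_add_one_self[of "\<rho> * (\<Sum>a\<in>A. \<Sum>b\<in>B. w a b * g a b) + \<rho>\<^sup>2 * Bd\<^sup>2"]
    by linarith
  finally show ?thesis .
qed

section \<open>Exponential bounds for words\<close>

lemma seqs_nth: "us \<in> seqs N A \<Longrightarrow> i < N \<Longrightarrow> us ! i \<in> A"
  by (auto simp: seqs_def)

text \<open>Chernoff bound with exponent \<open>- \<rho>\<close> for independent letters that need
  not be identically distributed, as the state varies from position to position.\<close>

lemma atypical_score_prob:
  fixes w :: "nat \<Rightarrow> 'u \<Rightarrow> 'y::finite \<Rightarrow> real"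
  assumes P: "\<And>u. u \<in> A \<Longrightarrow> 0 \<le> P u" "(\<Sum>u\<in>A. P u) = 1"
    and w: "\<And>i. i < N \<Longrightarrow> stochastic_on A (w i)"
    and Bd: "\<And>u y. u \<in> A \<Longrightarrow> \<bar>\<theta> u y\<bar> \<le> Bd" and \<rho>: "0 \<le> \<rho>" "\<rho> * Bd \<le> 1"
  shows "(\<Sum>us\<in>seqs N A. \<Sum>ys\<in>seqs N UNIV. (\<Prod>i<N. P (us ! i)) * (\<Prod>i<N. w i (us ! i) (ys ! i)) *
            of_bool ((\<Sum>i<N. \<theta> (us ! i) (ys ! i)) < a))
       \<le> exp (\<rho> * a - \<rho> * (\<Sum>i<N. \<Sum>u\<in>A. \<Sum>y\<in>UNIV. P u * w i u y * \<theta> u y) + real N * (\<rho>\<^sup>2 * Bd\<^sup>2))"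
proof -
  let ?g = "\<lambda>i u y. P u * w i u y * exp (- \<rho> * \<theta> u y)"
  have "(\<Sum>us\<in>seqs N A. \<Sum>ys\<in>seqs N UNIV. (\<Prod>i<N. P (us ! i)) * (\<Prod>i<N. w i (us ! i) (ys ! i)) *
            of_bool ((\<Sum>i<N. \<theta> (us ! i) (ys ! i)) < a))
      \<le> (\<Sum>us\<in>seqs N A. \<Sum>ys\<in>seqs N UNIV. exp (\<rho> * a) * (\<Prod>i<N. ?g i (us ! i) (ys ! i)))"
  proof (intro sum_mono)
    fix us :: "'u list" and ys :: "'y list" assume us: "us \<in> seqs N A"
    define S where "S = (\<Sum>i<N. \<theta> (us ! i) (ys ! i))"
    have "of_bool (S < a) \<le> exp (\<rho> * (a - S))" using \<rho> by auto
    also have "\<dots> = exp (\<rho> * a) * (\<Prod>i<N. exp (- \<rho> * \<theta> (us ! i) (ys ! i)))"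
      by (simp add: S_def exp_sum[symmetric] exp_add[symmetric] sum_distrib_left sum_negf algebra_simps)
    finally have *: "of_bool (S < a) \<le> exp (\<rho> * a) * (\<Prod>i<N. exp (- \<rho> * \<theta> (us ! i) (ys ! i)))" .
    have "0 \<le> (\<Prod>i<N. P (us ! i)) * (\<Prod>i<N. w i (us ! i) (ys ! i))"
      using w seqs_nth[OF us] P by (intro mult_nonneg_nonneg prod_nonneg) (auto simp: stochastic_on_def)
    from mult_left_mono[OF * this]
    show "(\<Prod>i<N. P (us ! i)) * (\<Prod>i<N. w i (us ! i) (ys ! i)) * of_bool ((\<Sum>i<N. \<theta> (us ! i) (ys ! i)) < a)
      \<le> exp (\<rho> * a) * (\<Prod>i<N. ?g i (us ! i) (ys ! i))"
      unfolding S_def by (simp add: prod.distrib mult_ac)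
  qed
  also have "\<dots> = exp (\<rho> * a) * (\<Prod>i<N. \<Sum>u\<in>A. \<Sum>y\<in>UNIV. ?g i u y)"
    unfolding sum_seqs_prod2[symmetric] sum_distrib_left ..
  also have "\<dots> \<le> exp (\<rho> * a) * (\<Prod>i<N. exp (- \<rho> * (\<Sum>u\<in>A. \<Sum>y\<in>UNIV. P u * w i u y * \<theta> u y) + (- \<rho>)\<^sup>2 * Bd\<^sup>2))"
  proof (intro mult_left_mono prod_mono conjI sum_exp_moment_le)
    fix i assume "i \<in> {..<N}"
    then have wi: "stochastic_on A (w i)" using w by auto
    then show "0 \<le> (\<Sum>u\<in>A. \<Sum>y\<in>UNIV. ?g i u y)"
      using P by (intro sum_nonneg mult_nonneg_nonneg) (auto simp: stochastic_on_def)
    show "0 \<le> P u * w i u y" if "u \<in> A" for u y using wi P that by (auto simp: stochastic_on_def)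
    have "(\<Sum>u\<in>A. \<Sum>y\<in>UNIV. P u * w i u y) = (\<Sum>u\<in>A. P u)"
      using wi by (intro sum.cong) (auto simp: stochastic_on_def sum_distrib_left[symmetric])
    then show "(\<Sum>u\<in>A. \<Sum>y\<in>UNIV. P u * w i u y) = 1" using P by simp
  qed (use Bd \<rho> in auto)
  also have "\<dots> = exp (\<rho> * a - \<rho> * (\<Sum>i<N. \<Sum>u\<in>A. \<Sum>y\<in>UNIV. P u * w i u y * \<theta> u y) + real N * (\<rho>\<^sup>2 * Bd\<^sup>2))"
    by (simp add: exp_sum[symmetric] exp_add[symmetric] sum.distrib sum_distrib_left sum_negf sum_subtractf)
  finally show ?thesis .
qed

text \<open>Markov's inequality for the exponential of the score. Its expectation is at most 1 for
  each fixed output word, so no channel appears.\<close>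

lemma false_codeword_prob:
  fixes P :: "'u \<Rightarrow> real" and \<theta> :: "'u \<Rightarrow> 'y \<Rightarrow> real"
  assumes P: "\<And>u. u \<in> A \<Longrightarrow> 0 \<le> P u" and \<theta>: "\<And>y. (\<Sum>u\<in>A. P u * exp (\<theta> u y)) \<le> 1"
  shows "(\<Sum>us\<in>seqs N A. (\<Prod>i<N. P (us ! i)) * of_bool (a \<le> (\<Sum>i<N. \<theta> (us ! i) (ys ! i)))) \<le> exp (- a)"
proof -
  have "(\<Sum>us\<in>seqs N A. (\<Prod>i<N. P (us ! i)) * of_bool (a \<le> (\<Sum>i<N. \<theta> (us ! i) (ys ! i))))
      \<le> (\<Sum>us\<in>seqs N A. exp (- a) * (\<Prod>i<N. P (us ! i) * exp (\<theta> (us ! i) (ys ! i))))"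
  proof (intro sum_mono)
    fix us assume us: "us \<in> seqs N A"
    define S where "S = (\<Sum>i<N. \<theta> (us ! i) (ys ! i))"
    have "of_bool (a \<le> S) \<le> exp (S - a)" by auto
    moreover have "0 \<le> (\<Prod>i<N. P (us ! i))" using seqs_nth[OF us] P by (intro prod_nonneg) auto
    ultimately have "(\<Prod>i<N. P (us ! i)) * of_bool (a \<le> S) \<le> (\<Prod>i<N. P (us ! i)) * exp (S - a)"
      by (intro mult_left_mono)
    then show "(\<Prod>i<N. P (us ! i)) * of_bool (a \<le> (\<Sum>i<N. \<theta> (us ! i) (ys ! i)))
        \<le> exp (- a) * (\<Prod>i<N. P (us ! i) * exp (\<theta> (us ! i) (ys ! i)))"
      unfolding S_def by (simp add: prod.distrib exp_sum exp_diff exp_minus divide_inverse mult_ac)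
  qed
  also have "\<dots> = exp (- a) * (\<Prod>i<N. \<Sum>u\<in>A. P u * exp (\<theta> u (ys ! i)))"
    unfolding sum_distrib_left[symmetric] by (subst sum_seqs_prod[of "\<lambda>i u. P u * exp (\<theta> u (ys ! i))"]) simp
  also have "\<dots> \<le> exp (- a) * (\<Prod>i<N. 1)"
    using \<theta> P by (intro mult_left_mono prod_mono) (auto intro!: sum_nonneg)
  finally show ?thesis by simp
qed

text \<open>After \<open>ln_one_plus_le_powr\<close> the sum factors into exponential moments of the
  letterwise information densities, whose means are the mutual informations.\<close>

lemma soft_covering_exponent:
  fixes v :: "nat \<Rightarrow> 'u \<Rightarrow> 'z::finite \<Rightarrow> real"
  assumes fin: "finite A" and P: "\<And>u. u \<in> A \<Longrightarrow> 0 < P u" "(\<Sum>u\<in>A. P u) = 1"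
    and v: "\<And>i. i < N \<Longrightarrow> stochastic_on A (v i)"
    and Q: "\<And>i z. Q i z = (\<Sum>u\<in>A. P u * v i u z)"
    and Bd: "\<And>i u z. i < N \<Longrightarrow> u \<in> A \<Longrightarrow> \<bar>ln (v i u z / Q i z)\<bar> \<le> Bd"
    and \<rho>: "0 < \<rho>" "\<rho> \<le> 1" "\<rho> * Bd \<le> 1" and L: "0 < L"
  shows "(\<Sum>us\<in>seqs N A. \<Sum>zs\<in>seqs N UNIV. (\<Prod>i<N. P (us ! i)) * (\<Prod>i<N. v i (us ! i) (zs ! i)) *
            ln (1 + (\<Prod>i<N. v i (us ! i) (zs ! i)) / (L * (\<Prod>i<N. Q i (zs ! i)))))
       \<le> 2 / \<rho> * L powr (- \<rho>) * exp (\<rho> * (\<Sum>i<N. mi_nats A P (v i)) + real N * (\<rho>\<^sup>2 * Bd\<^sup>2))"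
proof -
  let ?g = "\<lambda>i u z. P u * v i u z * exp (\<rho> * ln (v i u z / Q i z))"
  have v0: "0 \<le> v i u z" if "i < N" "u \<in> A" for i u z using v that by (auto simp: stochastic_on_def)
  have P0: "0 \<le> P u" if "u \<in> A" for u using P(1)[OF that] by simp
  have Q0: "0 \<le> Q i z" if "i < N" for i z unfolding Q using v0 P0 that by (intro sum_nonneg mult_nonneg_nonneg)
  \<comment> \<open>Where \<open>v i u z = 0\<close> both sides carry a factor 0; elsewhere
    \<open>Q i z\<close> is positive and \<open>powr\<close> unfolds to \<open>exp\<close> of a
    logarithm.\<close>
  have g: "P u * v i u z * (v i u z / Q i z) powr \<rho> = ?g i u z" if "i < N" "u \<in> A" for i u z
  proof (cases "v i u z = 0")
    case False
    have "P u * v i u z \<le> Q i z" unfolding Q by (rule member_le_sum) (use that v0 P0 fin in auto)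
    moreover have "0 < P u * v i u z" using False v0[OF that, of z] P that by simp
    ultimately have "Q i z \<noteq> 0" by linarith
    then show ?thesis using False by (simp add: powr_def)
  qed simp
  have "(\<Sum>us\<in>seqs N A. \<Sum>zs\<in>seqs N UNIV. (\<Prod>i<N. P (us ! i)) * (\<Prod>i<N. v i (us ! i) (zs ! i)) *
            ln (1 + (\<Prod>i<N. v i (us ! i) (zs ! i)) / (L * (\<Prod>i<N. Q i (zs ! i)))))
      \<le> (\<Sum>us\<in>seqs N A. \<Sum>zs\<in>seqs N UNIV. 2 / \<rho> * L powr (- \<rho>) * (\<Prod>i<N. ?g i (us ! i) (zs ! i)))"
  proof (intro sum_mono)
    fix us :: "'u list" and zs :: "'z list" assume us: "us \<in> seqs N A"
    define a where "a = (\<Prod>i<N. v i (us ! i) (zs ! i))"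
    define q where "q = (\<Prod>i<N. Q i (zs ! i))"
    define p where "p = (\<Prod>i<N. P (us ! i))"
    have a0: "0 \<le> a" unfolding a_def using v0 seqs_nth[OF us] by (intro prod_nonneg) auto
    have p0: "0 \<le> p" unfolding p_def using P0 seqs_nth[OF us] by (intro prod_nonneg) auto
    have q0: "0 \<le> q" unfolding q_def using Q0 by (intro prod_nonneg) auto
    have "a / q = (\<Prod>i<N. v i (us ! i) (zs ! i) / Q i (zs ! i))" unfolding a_def q_def by (simp add: prod_dividef)
    then have pw: "(a / q) powr \<rho> = (\<Prod>i<N. (v i (us ! i) (zs ! i) / Q i (zs ! i)) powr \<rho>)"
      using v0 Q0 seqs_nth[OF us] by (simp add: prod_powr_distrib)
    have prod_eq: "p * a * (a / q) powr \<rho> = (\<Prod>i<N. ?g i (us ! i) (zs ! i))"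
      unfolding pw unfolding p_def a_def prod.distrib[symmetric] using g seqs_nth[OF us] by (intro prod.cong) auto
    have "p * a * ln (1 + a / (L * q)) \<le> p * a * (2 / \<rho> * L powr (- \<rho>) * (a / q) powr \<rho>)"
    proof (intro mult_left_mono)
      have "ln (1 + a / (L * q)) \<le> 2 * (a / (L * q)) powr \<rho> / \<rho>"
        using a0 q0 L \<rho> by (intro ln_one_plus_le_powr) auto
      also have "a / (L * q) = (a / q) * (1 / L)" by simp
      also have "((a / q) * (1 / L)) powr \<rho> = (a / q) powr \<rho> * L powr (- \<rho>)"
        using a0 q0 L by (subst powr_mult) (auto simp: powr_divide powr_minus_divide)
      finally show "ln (1 + a / (L * q)) \<le> 2 / \<rho> * L powr (- \<rho>) * (a / q) powr \<rho>"
        by (simp add: mult_ac)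
    qed (use p0 a0 in auto)
    then show "(\<Prod>i<N. P (us ! i)) * (\<Prod>i<N. v i (us ! i) (zs ! i)) *
        ln (1 + (\<Prod>i<N. v i (us ! i) (zs ! i)) / (L * (\<Prod>i<N. Q i (zs ! i))))
      \<le> 2 / \<rho> * L powr (- \<rho>) * (\<Prod>i<N. ?g i (us ! i) (zs ! i))"
      unfolding a_def[symmetric] q_def[symmetric] p_def[symmetric] prod_eq[symmetric] by (simp add: mult_ac)
  qed
  also have "\<dots> = 2 / \<rho> * L powr (- \<rho>) * (\<Prod>i<N. \<Sum>u\<in>A. \<Sum>z\<in>UNIV. ?g i u z)"
    unfolding sum_seqs_prod2[symmetric] sum_distrib_left ..
  also have "\<dots> \<le> 2 / \<rho> * L powr (- \<rho>) * (\<Prod>i<N. exp (\<rho> * mi_nats A P (v i) + \<rho>\<^sup>2 * Bd\<^sup>2))"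
  proof (intro mult_left_mono prod_mono conjI)
    fix i assume "i \<in> {..<N}"
    then have i: "i < N" by simp
    show "0 \<le> (\<Sum>u\<in>A. \<Sum>z\<in>UNIV. ?g i u z)"
      using P0 v0[OF i] by (intro sum_nonneg mult_nonneg_nonneg) auto
    have "(\<Sum>u\<in>A. \<Sum>z\<in>UNIV. P u * v i u z) = (\<Sum>u\<in>A. P u)"
      using v[OF i] by (intro sum.cong) (auto simp: stochastic_on_def sum_distrib_left[symmetric])
    then show "(\<Sum>u\<in>A. \<Sum>z\<in>UNIV. ?g i u z) \<le> exp (\<rho> * mi_nats A P (v i) + \<rho>\<^sup>2 * Bd\<^sup>2)"
      unfolding mi_nats_def Q[symmetric]
      using P0 v0[OF i] Bd[OF i] \<rho> P(2) by (intro sum_exp_moment_le) auto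
  qed (use \<rho> in auto)
  also have "\<dots> = 2 / \<rho> * L powr (- \<rho>) * exp (\<rho> * (\<Sum>i<N. mi_nats A P (v i)) + real N * (\<rho>\<^sup>2 * Bd\<^sup>2))"
    by (simp add: exp_sum[symmetric] sum.distrib sum_distrib_left)
  finally show ?thesis .
qed

section \<open>Random coding\<close>

definition concat_channel :: "('u \<Rightarrow> 'x::finite \<Rightarrow> real) \<Rightarrow> ('x \<Rightarrow> 'y \<Rightarrow> real) \<Rightarrow> 'u \<Rightarrow> 'y \<Rightarrow> real" where
  "concat_channel \<kappa> T u y = (\<Sum>x\<in>UNIV. \<kappa> u x * T x y)"

lemma stochastic_on_concat:
  fixes \<kappa> :: "'u \<Rightarrow> 'x::finite \<Rightarrow> real" and T :: "'x \<Rightarrow> 'y::finite \<Rightarrow> real"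
  assumes "stochastic_on A \<kappa>" "\<And>x y. 0 \<le> T x y" "\<And>x. (\<Sum>y\<in>UNIV. T x y) = 1"
  shows "stochastic_on A (concat_channel \<kappa> T)"
proof -
  have "(\<Sum>y\<in>UNIV. concat_channel \<kappa> T u y) = (\<Sum>x\<in>UNIV. \<kappa> u x * (\<Sum>y\<in>UNIV. T x y))" for u
    unfolding concat_channel_def by (subst sum.swap) (simp add: sum_distrib_left)
  then show ?thesis using assms
    by (auto simp: stochastic_on_def concat_channel_def intro!: sum_nonneg)
qed

lemma sum_kernel_block_prob:
  assumes "length ss = N"
  shows "(\<Sum>xs\<in>seqs N UNIV. (\<Prod>i<N. \<kappa> (us ! i) (xs ! i)) * block_prob T ys xs ss)
       = (\<Prod>i<N. concat_channel \<kappa> (T (ss ! i)) (us ! i) (ys ! i))"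
  unfolding block_prob_def assms prod.distrib[symmetric] concat_channel_def
  by (rule sum_seqs_prod[where g = "\<lambda>i x. \<kappa> (us ! i) x * T (ss ! i) x (ys ! i)"])

text \<open>The code is the entire codebook ensemble and is fixed before \<open>ss\<close>; both
  quantities are averages over codebooks, so one code meets the bounds for all state sequences. The
  cost constraint comes in later, through the means inside the exponents.\<close>

lemma random_coding_bounds:
  fixes W :: "'s::finite \<Rightarrow> 'x::finite \<Rightarrow> 'y::finite \<Rightarrow> real" and V :: "'s \<Rightarrow> 'x \<Rightarrow> 'z::finite \<Rightarrow> real"
    and \<kappa> :: "'u \<Rightarrow> 'x \<Rightarrow> real"
  assumes W: "channel_family W" and V: "channel_family V"
    and fin: "finite A" and P: "\<And>u. u \<in> A \<Longrightarrow> 0 < P u" "(\<Sum>u\<in>A. P u) = 1"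
    and \<kappa>: "stochastic_on A \<kappa>"
    and \<theta>: "\<And>y. (\<Sum>u\<in>A. P u * exp (\<theta> u y)) \<le> 1"
    and Bd: "\<And>u y. u \<in> A \<Longrightarrow> \<bar>\<theta> u y\<bar> \<le> Bd"
      "\<And>s u z. u \<in> A \<Longrightarrow> \<bar>ln (concat_channel \<kappa> (V s) u z / (\<Sum>u\<in>A. P u * concat_channel \<kappa> (V s) u z))\<bar> \<le> Bd"
    and \<rho>: "0 < \<rho>" "\<rho> \<le> 1" "\<rho> * Bd \<le> 1" and Mn: "0 < Mn" and L: "0 < L"
  obtains G \<pi> f and \<phi> :: "nat \<Rightarrow> 'y list \<Rightarrow> nat" where "random_code N Mn G \<pi> f \<phi>"
    and "\<And>ss. ss \<in> seqs N UNIV \<Longrightarrow> max_err W N Mn G \<pi> f \<phi> ss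
       \<le> exp (\<rho> * a - \<rho> * (\<Sum>i<N. \<Sum>u\<in>A. \<Sum>y\<in>UNIV. P u * concat_channel \<kappa> (W (ss ! i)) u y * \<theta> u y)
              + real N * (\<rho>\<^sup>2 * Bd\<^sup>2)) + (real Mn - 1) * real L * exp (- a)"
    and "\<And>ss. ss \<in> seqs N UNIV \<Longrightarrow> secrecy_leak V N Mn G \<pi> f \<phi> ss
       \<le> 2 / \<rho> * real L powr (- \<rho>) *
          exp (\<rho> * (\<Sum>i<N. mi_nats A P (concat_channel \<kappa> (V (ss ! i)))) + real N * (\<rho>\<^sup>2 * Bd\<^sup>2)) / ln 2"
proof -
  let ?U = "seqs N A" and ?X = "seqs N (UNIV::'x set)" and ?Y = "seqs N (UNIV::'y set)"
    and ?Z = "seqs N (UNIV::'z set)"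
  let ?J = "{..<Mn} \<times> {..<L}"
  define p where "p us = (\<Prod>i<N. P (us ! i))" for us
  define k where "k us xs = (\<Prod>i<N. \<kappa> (us ! i) (xs ! i))" for us xs
  define K where "K = PiE ?J (\<lambda>_. ?U)"
  define \<mu> where "\<mu> C = (\<Prod>j\<in>?J. p (C j))" for C
  define e where "e C m xs = (\<Sum>l<L. k (C (m, l)) xs) / real L" for C :: "nat \<times> nat \<Rightarrow> 'u list" and m xs
  define S where "S us ys = (\<Sum>i<N. \<theta> (us ! i) (ys ! i))" for us ys
  define \<psi> where "\<psi> = threshold_decoder Mn L S a"
  have finU: "finite ?U" using fin by (rule finite_seqs)
  have fins: "finite ?X" "finite ?Y" "finite ?Z" by (simp_all add: finite_seqs)
  have pp: "0 < p us" if "us \<in> ?U" for us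
    unfolding p_def using seqs_nth[OF that] P by (intro prod_pos) auto
  have p1: "(\<Sum>us\<in>?U. p us) = 1"
    unfolding p_def by (subst sum_seqs_prod[of "\<lambda>_. P"]) (simp add: P)
  have CU: "C j \<in> ?U" if "C \<in> K" "j \<in> ?J" for C j using that unfolding K_def by (auto simp: PiE_def Pi_def)
  have finK: "finite K" unfolding K_def using finU by (intro finite_PiE) auto
  have \<mu>p: "0 < \<mu> C" if "C \<in> K" for C
    unfolding \<mu>_def using CU[OF that] pp by (intro prod_pos) auto
  have \<mu>1: "(\<Sum>C\<in>K. \<mu> C) = 1"
    unfolding K_def \<mu>_def by (rule sum_PiE_weight[where w = "\<lambda>_. p"]) (use finU p1 in auto)
  have k0: "0 \<le> k us xs" if "us \<in> ?U" for us xs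
    unfolding k_def using seqs_nth[OF that] \<kappa> by (intro prod_nonneg) (auto simp: stochastic_on_def)
  have k1: "(\<Sum>xs\<in>?X. k us xs) = 1" if "us \<in> ?U" for us
    unfolding k_def by (subst sum_seqs_prod[of "\<lambda>i x. \<kappa> (us ! i) x"])
      (use seqs_nth[OF that] \<kappa> in \<open>simp add: stochastic_on_def\<close>)
  have e0: "0 \<le> e C m xs" if "C \<in> K" "m < Mn" for C m xs
    unfolding e_def using CU[OF that(1)] that by (intro divide_nonneg_nonneg sum_nonneg k0) auto
  have sum_e: "(\<Sum>xs\<in>?X. e C m xs * h xs) = (\<Sum>l<L. \<Sum>xs\<in>?X. k (C (m, l)) xs * h xs) / real L" for C m h
    unfolding e_def by (subst sum.swap) (simp add: sum_divide_distrib sum_distrib_right)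
  have e1: "(\<Sum>xs\<in>?X. e C m xs) = 1" if "C \<in> K" "m < Mn" for C m
    using sum_e[of C m "\<lambda>_. 1"] k1 CU[OF that(1)] that L by simp
  obtain G \<pi> f \<phi> where rc: "random_code N Mn G \<pi> f \<phi>"
    and exp_eq: "\<And>m F. m < Mn \<Longrightarrow> (\<Sum>g\<in>G. \<pi> g * F (\<phi> g) (f g m))
            = (\<Sum>C\<in>K. \<mu> C * (\<Sum>xs\<in>?X. e C m xs * (F (\<psi> C) xs :: real)))"
    and img: "\<phi> ` G = \<psi> ` K"
    by (rule random_code_of_stochastic_encoder[of K \<mu> Mn e N \<psi>])
      (use finK \<mu>p \<mu>1 Mn e0 e1 in \<open>auto simp: less_imp_le \<psi>_def threshold_decoder_less\<close>)
  have err: "max_err W N Mn G \<pi> f \<phi> ss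
       \<le> exp (\<rho> * a - \<rho> * (\<Sum>i<N. \<Sum>u\<in>A. \<Sum>y\<in>UNIV. P u * concat_channel \<kappa> (W (ss ! i)) u y * \<theta> u y)
              + real N * (\<rho>\<^sup>2 * Bd\<^sup>2)) + (real Mn - 1) * real L * exp (- a)" (is "_ \<le> ?bound")
    if ss: "ss \<in> seqs N UNIV" for ss
  proof -
    have len: "length ss = N" using ss by (simp add: seqs_def)
    define w where "w us ys = (\<Prod>i<N. concat_channel \<kappa> (W (ss ! i)) (us ! i) (ys ! i))" for us ys
    have st: "stochastic_on A (concat_channel \<kappa> (W s))" for s
      using W \<kappa> by (intro stochastic_on_concat) (auto simp: channel_family_def)
    have w0: "0 \<le> w us ys" if "us \<in> ?U" for us ys
      unfolding w_def using seqs_nth[OF that] st by (intro prod_nonneg) (auto simp: stochastic_on_def)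
    have w1: "(\<Sum>ys\<in>?Y. w us ys) = 1" if "us \<in> ?U" for us
      unfolding w_def by (subst sum_seqs_prod[of "\<lambda>i y. concat_channel \<kappa> (W (ss ! i)) (us ! i) y"])
        (use seqs_nth[OF that] st in \<open>simp add: stochastic_on_def\<close>)
    have "(\<Sum>g\<in>G. \<pi> g * (1 - (\<Sum>ys\<in>{ys\<in>?Y. \<phi> g ys = m}. block_prob W ys (f g m) ss))) \<le> ?bound"
      if m: "m < Mn" for m
    proof -
      have inner: "(\<Sum>xs\<in>?X. e C m xs * (1 - (\<Sum>ys\<in>{ys\<in>?Y. \<psi> C ys = m}. block_prob W ys xs ss)))
          = 1 - (\<Sum>l<L. \<Sum>ys\<in>{ys\<in>?Y. \<psi> C ys = m}. w (C (m, l)) ys) / real L" if C: "C \<in> K" for C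
      proof -
        have "(\<Sum>xs\<in>?X. k us xs * (\<Sum>ys\<in>D. block_prob W ys xs ss)) = (\<Sum>ys\<in>D. w us ys)" for us D
        proof -
          have "(\<Sum>xs\<in>?X. k us xs * (\<Sum>ys\<in>D. block_prob W ys xs ss))
              = (\<Sum>ys\<in>D. \<Sum>xs\<in>?X. k us xs * block_prob W ys xs ss)"
            by (subst sum.swap) (simp add: sum_distrib_left)
          then show ?thesis unfolding k_def w_def sum_kernel_block_prob[OF len] .
        qed
        then show ?thesis
          using e1[OF C m] by (simp add: right_diff_distrib sum_subtractf sum_e)
      qed
      have "(\<Sum>g\<in>G. \<pi> g * (1 - (\<Sum>ys\<in>{ys\<in>?Y. \<phi> g ys = m}. block_prob W ys (f g m) ss)))
        = (\<Sum>C\<in>K. \<mu> C * (\<Sum>xs\<in>?X. e C m xs * (1 - (\<Sum>ys\<in>{ys\<in>?Y. \<psi> C ys = m}. block_prob W ys xs ss))))"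
        using exp_eq[OF m, of "\<lambda>h xs. 1 - (\<Sum>ys\<in>{ys\<in>?Y. h ys = m}. block_prob W ys xs ss)"] .
      also have "\<dots> = (\<Sum>C\<in>K. \<mu> C * (1 - (\<Sum>l<L. \<Sum>ys\<in>{ys\<in>?Y. \<psi> C ys = m}. w (C (m, l)) ys) / real L))"
        using inner by (intro sum.cong) auto
      also have "\<dots> \<le> (\<Sum>us\<in>?U. \<Sum>ys\<in>?Y. p us * w us ys * of_bool (S us ys < a)) + (real Mn - 1) * real L * exp (- a)"
        unfolding K_def \<mu>_def \<psi>_def
      proof (rule threshold_decoder_error_prob)
        show "(\<Sum>us\<in>?U. p us * of_bool (a \<le> S us ys)) \<le> exp (- a)" for ys
          unfolding p_def S_def using P \<theta> by (intro false_codeword_prob) (auto simp: less_imp_le)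
      qed (use finU fins m L pp p1 w0 w1 in \<open>auto simp: less_imp_le\<close>)
      also have "(\<Sum>us\<in>?U. \<Sum>ys\<in>?Y. p us * w us ys * of_bool (S us ys < a))
         \<le> exp (\<rho> * a - \<rho> * (\<Sum>i<N. \<Sum>u\<in>A. \<Sum>y\<in>UNIV. P u * concat_channel \<kappa> (W (ss ! i)) u y * \<theta> u y)
              + real N * (\<rho>\<^sup>2 * Bd\<^sup>2))"
        unfolding p_def w_def S_def using P st Bd(1) \<rho>
        by (intro atypical_score_prob) (auto simp: less_imp_le)
      finally show ?thesis by simp
    qed
    then show ?thesis unfolding max_err_def using Mn by (intro Max.boundedI) auto
  qed
  have leak: "secrecy_leak V N Mn G \<pi> f \<phi> ss
       \<le> 2 / \<rho> * real L powr (- \<rho>) *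
          exp (\<rho> * (\<Sum>i<N. mi_nats A P (concat_channel \<kappa> (V (ss ! i)))) + real N * (\<rho>\<^sup>2 * Bd\<^sup>2)) / ln 2" (is "_ \<le> ?B / ln 2")
    if ss: "ss \<in> seqs N UNIV" for ss
  proof -
    have len: "length ss = N" using ss by (simp add: seqs_def)
    define v where "v us zs = (\<Prod>i<N. concat_channel \<kappa> (V (ss ! i)) (us ! i) (zs ! i))" for us zs
    define Q1 where "Q1 i z = (\<Sum>u\<in>A. P u * concat_channel \<kappa> (V (ss ! i)) u z)" for i z
    define Q where "Q zs = (\<Prod>i<N. Q1 i (zs ! i))" for zs
    \<comment> \<open>The conditioning variable of the leakage. It is a possibly non-injective
      function of the codebook, hence the grouping by \<open>r C = d\<close> below.\<close>
    define r where "r C = restrict (\<psi> C) ?Y" for C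
    define T where "T C m zs = (\<Sum>l<L. v (C (m, l)) zs) / real L" for C :: "nat \<times> nat \<Rightarrow> 'u list" and m zs
    have st: "stochastic_on A (concat_channel \<kappa> (V s))" for s
      using V \<kappa> by (intro stochastic_on_concat) (auto simp: channel_family_def)
    have v0: "0 \<le> v us zs" if "us \<in> ?U" for us zs
      unfolding v_def using seqs_nth[OF that] st by (intro prod_nonneg) (auto simp: stochastic_on_def)
    have v1: "(\<Sum>zs\<in>?Z. v us zs) = 1" if "us \<in> ?U" for us
      unfolding v_def by (subst sum_seqs_prod[of "\<lambda>i y. concat_channel \<kappa> (V (ss ! i)) (us ! i) y"])
        (use seqs_nth[OF that] st in \<open>simp add: stochastic_on_def\<close>)
    have Q_eq: "Q zs = (\<Sum>us\<in>?U. p us * v us zs)" for zs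
      unfolding Q_def Q1_def p_def v_def prod.distrib[symmetric]
      by (rule sum_seqs_prod[symmetric, of "\<lambda>i u. P u * concat_channel \<kappa> (V (ss ! i)) u (zs ! i)"])
    have Q0: "0 \<le> Q zs" for zs
      unfolding Q_eq using pp v0 by (intro sum_nonneg mult_nonneg_nonneg) (auto simp: less_imp_le)
    have Qsum: "(\<Sum>zs\<in>?Z. Q zs) = 1"
      unfolding Q_eq using v1 p1 by (subst sum.swap) (simp add: sum_distrib_left[symmetric])
    have vz: "v us zs = 0" if "Q zs = 0" "us \<in> ?U" for us zs
    proof -
      have "p us * v us zs \<le> Q zs" unfolding Q_eq
        by (rule member_le_sum) (use that pp v0 finU in \<open>auto simp: less_imp_le\<close>)
      then show ?thesis using that pp[OF that(2)] v0[OF that(2), of zs]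
        by (metis mult_pos_pos order.order_iff_strict not_le)
    qed
    have T0: "0 \<le> T C m zs" if "C \<in> K" "m < Mn" for C m zs
      unfolding T_def using CU[OF that(1)] that by (intro divide_nonneg_nonneg sum_nonneg v0) auto
    have T1: "(\<Sum>zs\<in>?Z. T C m zs) = 1" if "C \<in> K" "m < Mn" for C m
    proof -
      have "(\<Sum>zs\<in>?Z. T C m zs) = (\<Sum>l<L. \<Sum>zs\<in>?Z. v (C (m, l)) zs) / real L"
        unfolding T_def by (subst sum.swap) (simp add: sum_divide_distrib)
      also have "\<dots> = 1" using v1 CU[OF that(1)] that L by simp
      finally show ?thesis .
    qed
    have TQ: "T C m zs = 0" if "C \<in> K" "m < Mn" "Q zs = 0" for C m zs
      unfolding T_def using vz[OF that(3)] CU[OF that(1)] that(2) by simp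
    have joint: "secrecy_joint V N Mn G \<pi> f \<phi> ss m zs d
        = (\<Sum>C\<in>{C\<in>K. r C = d}. \<mu> C / real Mn * T C m zs)" if m: "m < Mn" for m zs d
    proof -
      have "secrecy_joint V N Mn G \<pi> f \<phi> ss m zs d
          = (\<Sum>g\<in>G. \<pi> g * (if restrict (\<phi> g) ?Y = d then 1 / real Mn * block_prob V zs (f g m) ss else 0))"
        unfolding secrecy_joint_def using rc
        by (subst sum.inter_filter) (auto simp: random_code_def intro!: sum.cong)
      also have "\<dots> = (\<Sum>C\<in>K. \<mu> C * (\<Sum>xs\<in>?X. e C m xs * (if restrict (\<psi> C) ?Y = d then 1 / real Mn * block_prob V zs xs ss else 0)))"
        using exp_eq[OF m, of "\<lambda>h xs. if restrict h ?Y = d then 1 / real Mn * block_prob V zs xs ss else 0"] .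
      also have "\<dots> = (\<Sum>C\<in>K. if r C = d then \<mu> C / real Mn * T C m zs else 0)"
      proof (intro sum.cong refl)
        fix C assume C: "C \<in> K"
        have "(\<Sum>xs\<in>?X. e C m xs * (1 / real Mn * block_prob V zs xs ss)) = T C m zs / real Mn"
        proof -
          have "(\<Sum>xs\<in>?X. e C m xs * (1 / real Mn * block_prob V zs xs ss))
              = (\<Sum>xs\<in>?X. e C m xs * block_prob V zs xs ss) / real Mn"
            by (simp add: sum_divide_distrib)
          also have "(\<Sum>xs\<in>?X. e C m xs * block_prob V zs xs ss) = T C m zs"
            unfolding sum_e T_def k_def v_def sum_kernel_block_prob[OF len] ..
          finally show ?thesis .
        qed
        then show "\<mu> C * (\<Sum>xs\<in>?X. e C m xs * (if restrict (\<psi> C) ?Y = d then 1 / real Mn * block_prob V zs xs ss else 0))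
            = (if r C = d then \<mu> C / real Mn * T C m zs else 0)"
          unfolding r_def by simp
      qed
      also have "\<dots> = (\<Sum>C\<in>{C\<in>K. r C = d}. \<mu> C / real Mn * T C m zs)"
        by (simp only: sum.inter_filter[OF finK])
      finally show ?thesis .
    qed
    have D: "(\<lambda>g. restrict (\<phi> g) ?Y) ` G = r ` K"
    proof -
      have "(\<lambda>g. restrict (\<phi> g) ?Y) ` G = (\<lambda>h. restrict h ?Y) ` (\<phi> ` G)" by auto
      then show ?thesis unfolding img r_def by auto
    qed
    have "secrecy_leak V N Mn G \<pi> f \<phi> ss
        \<le> (\<Sum>m<Mn. \<Sum>C\<in>K. \<mu> C * (\<Sum>zs\<in>?Z. T C m zs * ln (T C m zs / Q zs))) / (real Mn * ln 2)"
      unfolding secrecy_leak_def D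
      by (rule cond_mutual_info_le_divergence) (use finK fins Mn \<mu>p T0 T1 Q0 Qsum TQ joint in auto)
    also have "\<dots> \<le> (\<Sum>m<Mn. ?B) / (real Mn * ln 2)"
    proof (intro divide_right_mono sum_mono)
      fix m assume "m \<in> {..<Mn}"
      then have m: "m < Mn" by simp
      have "(\<Sum>C\<in>K. \<mu> C * (\<Sum>zs\<in>?Z. T C m zs * ln (T C m zs / Q zs)))
          \<le> (\<Sum>us\<in>?U. \<Sum>zs\<in>?Z. p us * v us zs * ln (1 + v us zs / (real (card ({m} \<times> {..<L})) * Q zs)))"
        unfolding K_def \<mu>_def
      \<comment> \<open>Only the row of \<open>m\<close> shapes the eavesdropper's output; the words
        of other messages are marginalised out.\<close>
      proof (rule soft_covering_divergence)
        show "T C m zs = (\<Sum>j\<in>{m} \<times> {..<L}. v (C j) zs) / real (card ({m} \<times> {..<L}))" for C zs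
          unfolding T_def by (simp add: sum.cartesian_product[symmetric, of "\<lambda>m l. v (C (m, l)) zs", simplified])
      qed (use finU fins m L pp p1 v0 Q_eq in auto)
      also have "real (card ({m} \<times> {..<L})) = real L" by simp
      also have "(\<Sum>us\<in>?U. \<Sum>zs\<in>?Z. p us * v us zs * ln (1 + v us zs / (real L * Q zs))) \<le> ?B"
        unfolding p_def v_def Q_def
        by (rule soft_covering_exponent) (use fin P st Q1_def Bd(2) \<rho> L in auto)
      finally show "(\<Sum>C\<in>K. \<mu> C * (\<Sum>zs\<in>?Z. T C m zs * ln (T C m zs / Q zs))) \<le> ?B" .
    qed simp
    also have "\<dots> = ?B / ln 2" using Mn by simp
    finally show ?thesis .
  qed
  show thesis using that[OF rc err leak] .
qed

section \<open>Achievability\<close>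

lemma mi_nats_nonneg:
  assumes fin: "finite A" and P: "\<And>u. u \<in> A \<Longrightarrow> 0 \<le> P u" "(\<Sum>u\<in>A. P u) = 1" and w: "stochastic_on A w"
  shows "0 \<le> mi_nats A P w"
proof -
  define Q where "Q y = (\<Sum>u\<in>A. P u * w u y)" for y
  have w0: "0 \<le> w u y" if "u \<in> A" for u y using w that by (auto simp: stochastic_on_def)
  have Q0: "0 \<le> Q y" for y unfolding Q_def using P w0 by (intro sum_nonneg mult_nonneg_nonneg)
  have sum_w: "(\<Sum>u\<in>A. \<Sum>y\<in>UNIV. P u * w u y) = 1"
    using w P by (simp add: stochastic_on_def sum_distrib_left[symmetric])
  have "P u * w u y - P u * Q y \<le> P u * w u y * ln (w u y / Q y)" if u: "u \<in> A" for u y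
  proof (cases "P u * w u y = 0")
    case True
    then show ?thesis using P(1)[OF u] Q0[of y] by auto
  next
    case False
    have "P u * w u y \<le> Q y" unfolding Q_def by (rule member_le_sum) (use u fin P w0 in auto)
    moreover have "0 < P u * w u y" using False w0[OF u, of y] P(1)[OF u] by (simp add: less_le)
    ultimately have "0 < Q y" "0 < P u * w u y" by linarith+
    then have pos: "0 < Q y" "0 < w u y" "0 < P u"
      using P(1)[OF u] by (auto simp: zero_less_mult_iff)
    have "ln (Q y / w u y) \<le> Q y / w u y - 1" using pos by (intro ln_le_minus_one) auto
    moreover have "ln (Q y / w u y) = - ln (w u y / Q y)" using pos by (simp add: ln_divide_pos)
    ultimately have "1 - Q y / w u y \<le> ln (w u y / Q y)" by linarith
    then have "P u * w u y * (1 - Q y / w u y) \<le> P u * w u y * ln (w u y / Q y)"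
      using pos by (intro mult_left_mono) auto
    moreover have "P u * w u y * (1 - Q y / w u y) = P u * w u y - P u * Q y"
      using pos by (simp add: field_simps)
    ultimately show ?thesis by simp
  qed
  then have "(\<Sum>u\<in>A. \<Sum>y\<in>UNIV. P u * w u y - P u * Q y) \<le> mi_nats A P w"
    unfolding mi_nats_def Q_def[symmetric] by (intro sum_mono)
  moreover have "(\<Sum>y\<in>UNIV. Q y) = 1" unfolding Q_def using sum_w by (subst sum.swap) simp
  then have "(\<Sum>u\<in>A. \<Sum>y\<in>UNIV. P u * w u y - P u * Q y) = 0"
    using sum_w P by (simp add: sum_subtractf sum_distrib_left[symmetric])
  ultimately show ?thesis by simp
qed

text \<open>Factors the joint law into a codeword law and a test channel. Letters of probability 0
  contribute nothing to the information and are dropped.\<close>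

lemma mi_aux_eq_mi_nats:
  fixes PUX :: "nat \<Rightarrow> 'x::finite \<Rightarrow> real" and T :: "'x \<Rightarrow> 'y::finite \<Rightarrow> real"
  assumes aux: "is_aux_pmf k PUX" and T: "\<And>x. (\<Sum>y\<in>UNIV. T x y) = 1"
    and P: "\<And>u. P u = (\<Sum>x\<in>UNIV. PUX u x)" and A: "A = {u. u < k \<and> 0 < P u}"
    and \<kappa>: "\<And>u x. \<kappa> u x = PUX u x / P u"
  shows "mi_aux k PUX T = mi_nats A P (concat_channel \<kappa> T) / ln 2"
proof -
  define j where "j u y = (\<Sum>x\<in>UNIV. PUX u x * T x y)" for u y
  have PUX: "0 \<le> PUX u x" for u x using aux by (simp add: is_aux_pmf_def)
  have P0: "0 \<le> P u" for u unfolding P using PUX by (intro sum_nonneg) auto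
  have jA: "j u y = P u * concat_channel \<kappa> T u y" for u y
  proof (cases "P u = 0")
    case True
    then have "PUX u x = 0" for x
      using PUX unfolding P by (subst (asm) sum_nonneg_eq_0_iff) auto
    then show ?thesis using True by (simp add: j_def)
  next
    case False
    then show ?thesis unfolding j_def concat_channel_def \<kappa> sum_distrib_left by (intro sum.cong) auto
  qed
  have j_row: "(\<Sum>y\<in>UNIV. j u y) = P u" for u
    unfolding j_def P by (subst sum.swap) (simp add: sum_distrib_left[symmetric] T)
  have sub: "A \<subseteq> {..<k}" unfolding A by auto
  have Pz: "P u = 0" if "u \<in> {..<k} - A" for u using that P0[of u] unfolding A by auto
  have j_col: "(\<Sum>u<k. j u y) = (\<Sum>u\<in>A. P u * concat_channel \<kappa> T u y)" for y
    unfolding jA by (rule sum.mono_neutral_right) (use sub Pz in auto)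
  have "mi_aux k PUX T = (\<Sum>u<k. \<Sum>y\<in>UNIV. if j u y = 0 then 0
      else j u y * log 2 (j u y / (P u * (\<Sum>u\<in>A. P u * concat_channel \<kappa> T u y))))"
    unfolding mi_aux_def mutual_info_def j_def[symmetric] j_row j_col ..
  also have "\<dots> = (\<Sum>u\<in>A. \<Sum>y\<in>UNIV. if j u y = 0 then 0
      else j u y * log 2 (j u y / (P u * (\<Sum>u\<in>A. P u * concat_channel \<kappa> T u y))))"
    by (rule sum.mono_neutral_right) (use sub Pz jA in auto)
  also have "\<dots> = mi_nats A P (concat_channel \<kappa> T) / ln 2"
    unfolding mi_nats_def sum_divide_distrib
  proof (intro sum.cong refl)
    fix u y assume "u \<in> A"
    then have "P u \<noteq> 0" unfolding A by auto
    then show "(if j u y = 0 then 0 else j u y * log 2 (j u y / (P u * (\<Sum>u\<in>A. P u * concat_channel \<kappa> T u y))))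
        = P u * concat_channel \<kappa> T u y * ln (concat_channel \<kappa> T u y / (\<Sum>u\<in>A. P u * concat_channel \<kappa> T u y)) / ln 2"
      by (simp add: jA log_def)
  qed
  finally show ?thesis .
qed

text \<open>The empirical distribution has the same cost as the sequence, so admissible sequences
  yield admissible state laws, and every sum over positions becomes an expectation.\<close>

lemma empirical_pmf:
  fixes ss :: "'s::finite list"
  assumes ss: "ss \<in> seqs N UNIV" and N: "0 < N" and cost: "cost_seq c ss \<le> \<Lambda>"
  obtains q where "q \<in> pmfs_cost c \<Lambda>"
    and "\<And>g :: 's \<Rightarrow> real. (\<Sum>i<N. g (ss ! i)) = real N * (\<Sum>s\<in>UNIV. q s * g s)"
proof -
  define q where "q s = real (card {i\<in>{..<N}. ss ! i = s}) / real N" for s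
  have sum_q: "(\<Sum>i<N. g (ss ! i)) = real N * (\<Sum>s\<in>UNIV. q s * g s)" for g :: "'s \<Rightarrow> real"
  proof -
    have "(\<Sum>i<N. g (ss ! i)) = (\<Sum>s\<in>UNIV. \<Sum>i\<in>{i\<in>{..<N}. ss ! i = s}. g (ss ! i))"
      by (rule sum.group[symmetric]) auto
    also have "\<dots> = (\<Sum>s\<in>UNIV. real N * (q s * g s))"
      using N by (intro sum.cong refl) (simp add: q_def)
    finally show ?thesis by (simp add: sum_distrib_left)
  qed
  have "is_pmf q" unfolding is_pmf_def using sum_q[of "\<lambda>_. 1"] N by (auto simp: q_def)
  moreover have "cost_pmf c q = cost_seq c ss"
    using sum_q[of c] ss N by (simp add: cost_pmf_def cost_seq_def seqs_def mult.commute)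
  ultimately have "q \<in> pmfs_cost c \<Lambda>" using cost by (simp add: pmfs_cost_def)
  then show thesis using sum_q by (rule that)
qed

lemma avg_channel_stochastic:
  assumes "channel_family W" "is_pmf q"
  shows "0 \<le> avg_channel W q x y" "(\<Sum>y\<in>UNIV. avg_channel W q x y) = 1"
proof -
  show "0 \<le> avg_channel W q x y"
    using assms by (auto simp: avg_channel_def channel_family_def is_pmf_def intro!: sum_nonneg)
  have "(\<Sum>y\<in>UNIV. avg_channel W q x y) = (\<Sum>s\<in>UNIV. q s * (\<Sum>y\<in>UNIV. W s x y))"
    unfolding avg_channel_def by (subst sum.swap) (simp add: sum_distrib_left)
  then show "(\<Sum>y\<in>UNIV. avg_channel W q x y) = 1"
    using assms by (simp add: channel_family_def is_pmf_def)
qed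

lemma concat_avg_channel:
  "concat_channel \<kappa> (avg_channel W q) u y = (\<Sum>s\<in>UNIV. q s * concat_channel \<kappa> (W s) u y)"
  unfolding concat_channel_def avg_channel_def sum_distrib_left
  by (subst sum.swap) (simp add: mult_ac)

lemma pmfs_cost_convex:
  assumes "q \<in> pmfs_cost c \<Lambda>" "q' \<in> pmfs_cost c \<Lambda>" "0 \<le> t" "t \<le> 1"
  shows "(\<lambda>s. (1 - t) * q s + t * q' s) \<in> pmfs_cost c \<Lambda>"
proof -
  have "cost_pmf c (\<lambda>s. (1 - t) * q s + t * q' s) = (1 - t) * cost_pmf c q + t * cost_pmf c q'"
    by (simp add: cost_pmf_def algebra_simps sum.distrib sum_distrib_left sum_subtractf)
  also have "\<dots> \<le> (1 - t) * \<Lambda> + t * \<Lambda>"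
    using assms by (intro add_mono mult_left_mono) (auto simp: pmfs_cost_def)
  finally have "cost_pmf c (\<lambda>s. (1 - t) * q s + t * q' s) \<le> \<Lambda>" by (simp add: algebra_simps)
  moreover have "(\<Sum>s\<in>UNIV. (1 - t) * q s + t * q' s) = 1"
    using assms by (simp add: pmfs_cost_def is_pmf_def sum.distrib sum_distrib_left[symmetric])
  ultimately show ?thesis using assms by (auto simp: pmfs_cost_def is_pmf_def)
qed

lemma nat_ceiling_bounds:
  fixes x :: real
  assumes "0 < x"
  shows "0 < nat \<lceil>x\<rceil>" "x \<le> real (nat \<lceil>x\<rceil>)" "real (nat \<lceil>x\<rceil>) - 1 \<le> x"
  using assms by linarith+

lemma eventually_exp_decay:
  fixes k b \<epsilon> :: real
  assumes "0 < k" "0 < \<epsilon>"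
  shows "\<forall>\<^sub>F N in sequentially. b * exp (- (real N * k)) < \<epsilon>"
proof -
  have "(\<lambda>N. b * exp (- k) ^ N) \<longlonglongrightarrow> b * 0"
    using assms by (intro tendsto_mult tendsto_const LIMSEQ_power_zero) auto
  then have "\<forall>\<^sub>F N in sequentially. b * exp (- k) ^ N < \<epsilon>"
    using assms by (intro order_tendstoD) auto
  then show ?thesis by (simp add: exp_of_nat_mult[symmetric])
qed

text \<open>If every state costs more than \<open>\<Lambda>\<close>, no nonempty state sequence is
  admissible: its empirical law would be. Error and secrecy are then vacuous, and any code with
  enough messages works.\<close>

lemma achievable_random_no_states:
  fixes W :: "'s::finite \<Rightarrow> 'x::finite \<Rightarrow> 'y::finite \<Rightarrow> real" and V :: "'s \<Rightarrow> 'x \<Rightarrow> 'z::finite \<Rightarrow> real"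
  assumes "pmfs_cost c \<Lambda> = {}" "0 \<le> R"
  shows "achievable_random W V c \<Lambda> R"
  unfolding achievable_random_def
proof (intro conjI allI impI assms)
  fix \<epsilon> :: real assume \<epsilon>: "0 < \<epsilon>"
  have "\<exists>Mn G \<pi> f (\<phi> :: nat \<Rightarrow> 'y list \<Rightarrow> nat). random_code N Mn G \<pi> f \<phi> \<and> R - \<epsilon> < log 2 (real Mn) / real N \<and>
      (\<forall>ss\<in>seqs N UNIV. cost_seq c ss \<le> \<Lambda> \<longrightarrow> max_err W N Mn G \<pi> f \<phi> ss < \<epsilon>) \<and>
      (\<forall>ss\<in>seqs N UNIV. cost_seq c ss \<le> \<Lambda> \<longrightarrow> secrecy_leak V N Mn G \<pi> f \<phi> ss < \<epsilon>)" if N: "1 \<le> N" for N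
  proof -
    define Mn where "Mn = nat \<lceil>2 powr (real N * R)\<rceil>"
    have Mn: "0 < Mn" "2 powr (real N * R) \<le> real Mn"
      using nat_ceiling_bounds[of "2 powr (real N * R)"] by (auto simp: Mn_def)
    then have "real N * R \<le> log 2 (real Mn)" by (simp add: le_log_iff)
    then have "R \<le> log 2 (real Mn) / real N" using N by (simp add: field_simps)
    moreover have "random_code N Mn {0} (\<lambda>_. 1) (\<lambda>_ _. replicate N undefined) (\<lambda>_ (_::'y list). 0)"
      using Mn by (simp add: random_code_def)
    moreover have "\<not> cost_seq c ss \<le> \<Lambda>" if "ss \<in> seqs N UNIV" for ss
      using empirical_pmf[OF that, of c \<Lambda>] N assms by force
    ultimately show ?thesis using \<epsilon> by (intro exI[of _ Mn] exI[of _ "{0}"] exI conjI) (assumption, linarith, blast+)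
  qed
  then show "\<exists>N0. \<forall>N\<ge>N0. \<exists>Mn G \<pi> f (\<phi> :: nat \<Rightarrow> 'y list \<Rightarrow> nat). random_code N Mn G \<pi> f \<phi> \<and> R - \<epsilon> < log 2 (real Mn) / real N \<and>
      (\<forall>ss\<in>seqs N UNIV. cost_seq c ss \<le> \<Lambda> \<longrightarrow> max_err W N Mn G \<pi> f \<phi> ss < \<epsilon>) \<and>
      (\<forall>ss\<in>seqs N UNIV. cost_seq c ss \<le> \<Lambda> \<longrightarrow> secrecy_leak V N Mn G \<pi> f \<phi> ss < \<epsilon>)"
    by blast
qed

theorem theorem4:
  fixes W :: "'s::finite \<Rightarrow> 'x::finite \<Rightarrow> 'y::finite \<Rightarrow> real"
    and V :: "'s \<Rightarrow> 'x \<Rightarrow> 'z::finite \<Rightarrow> real"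
    and c :: "'s \<Rightarrow> real" and \<Lambda> R :: real
  assumes "channel_family W" and "channel_family V"
    and "\<forall>s. 0 \<le> c s" and "\<Lambda> > 0"
    and "R \<ge> 0"
    and "\<exists>k PUX. is_aux_pmf k PUX \<and>
           R \<le> Inf ((\<lambda>q. mi_aux k PUX (avg_channel W q)) ` pmfs_cost c \<Lambda>)
              - Sup ((\<lambda>q'. avg_mi_aux k PUX V q') ` pmfs_cost c \<Lambda>)"
  shows "achievable_random W V c \<Lambda> R"
proof (cases "pmfs_cost c \<Lambda> = {}")
  \<comment> \<open>Over an empty set \<open>Inf\<close> and \<open>Sup\<close> carry no
    information, so this case is separated.\<close>
  case True
  then show ?thesis using assms(5) by (rule achievable_random_no_states)
next
  case False
  note W = assms(1) and V = assms(2)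
  obtain k PUX where aux: "is_aux_pmf k PUX"
    and R: "R \<le> Inf ((\<lambda>q. mi_aux k PUX (avg_channel W q)) ` pmfs_cost c \<Lambda>)
              - Sup ((\<lambda>q'. avg_mi_aux k PUX V q') ` pmfs_cost c \<Lambda>)"
    using assms(6) by blast
  define P where "P u = (\<Sum>x\<in>UNIV. PUX u x)" for u
  \<comment> \<open>On the support the conditional law \<open>\<kappa>\<close> is well defined and
    the codeword law strictly positive, as soft covering demands.\<close>
  define A where "A = {u. u < k \<and> 0 < P u}"
  define \<kappa> where "\<kappa> u x = PUX u x / P u" for u x
  have fin: "finite A" unfolding A_def by auto
  have Pp: "0 < P u" if "u \<in> A" for u using that by (simp add: A_def)
  have PUX0: "0 \<le> PUX u x" for u x using aux by (simp add: is_aux_pmf_def)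
  have P1: "(\<Sum>u\<in>A. P u) = 1"
  proof -
    have "P u = 0" if "u \<in> {..<k} - A" for u
      using that PUX0 sum_nonneg[of UNIV "PUX u"] by (force simp: A_def P_def)
    then have "(\<Sum>u\<in>A. P u) = (\<Sum>u<k. P u)" by (intro sum.mono_neutral_left) (auto simp: A_def)
    then show ?thesis using aux by (simp add: is_aux_pmf_def P_def)
  qed
  have \<kappa>: "stochastic_on A \<kappa>"
    using Pp PUX0 unfolding stochastic_on_def \<kappa>_def sum_divide_distrib[symmetric] P_def[symmetric]
    by (force intro: divide_nonneg_pos)
  have V_st: "stochastic_on A (concat_channel \<kappa> (V s))" for s
    using V \<kappa> by (intro stochastic_on_concat) (auto simp: channel_family_def)
  have Wq_st: "stochastic_on A (concat_channel \<kappa> (avg_channel W q))" if "q \<in> pmfs_cost c \<Lambda>" for q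
    using that avg_channel_stochastic[OF W] \<kappa> by (intro stochastic_on_concat) (auto simp: pmfs_cost_def)
  \<comment> \<open>The extrema in nats. They enter only as a lower bound \<open>I1\<close> and an
    upper bound \<open>I2\<close>, so attainment never has to be shown.\<close>
  define I1 where "I1 = ln 2 * Inf ((\<lambda>q. mi_aux k PUX (avg_channel W q)) ` pmfs_cost c \<Lambda>)"
  define I2 where "I2 = ln 2 * Sup ((\<lambda>q'. avg_mi_aux k PUX V q') ` pmfs_cost c \<Lambda>)"
  have miW: "mi_aux k PUX (avg_channel W q) = mi_nats A P (concat_channel \<kappa> (avg_channel W q)) / ln 2"
    if "q \<in> pmfs_cost c \<Lambda>" for q
    by (rule mi_aux_eq_mi_nats) (use aux that avg_channel_stochastic[OF W] in \<open>auto simp: P_def A_def \<kappa>_def pmfs_cost_def\<close>)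
  have miV: "mi_aux k PUX (V s) = mi_nats A P (concat_channel \<kappa> (V s)) / ln 2" for s
    by (rule mi_aux_eq_mi_nats) (use aux V in \<open>auto simp: P_def A_def \<kappa>_def channel_family_def\<close>)
  have miV0: "0 \<le> mi_aux k PUX (V s)" for s
    unfolding miV using mi_nats_nonneg[OF fin _ P1 V_st] Pp by (simp add: less_imp_le)
  have I1: "I1 \<le> mi_nats A P (concat_channel \<kappa> (avg_channel W q))" if q: "q \<in> pmfs_cost c \<Lambda>" for q
  proof -
    have "Inf ((\<lambda>q. mi_aux k PUX (avg_channel W q)) ` pmfs_cost c \<Lambda>) \<le> mi_aux k PUX (avg_channel W q)"
    proof (rule cInf_lower)
      have "0 \<le> mi_aux k PUX (avg_channel W q)" if "q \<in> pmfs_cost c \<Lambda>" for q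
        unfolding miW[OF that] using mi_nats_nonneg[OF fin _ P1 Wq_st[OF that]] Pp by (simp add: less_imp_le)
      then show "bdd_below ((\<lambda>q. mi_aux k PUX (avg_channel W q)) ` pmfs_cost c \<Lambda>)"
        by (intro bdd_belowI[of _ 0]) auto
    qed (use q in auto)
    then have "I1 \<le> ln 2 * mi_aux k PUX (avg_channel W q)" unfolding I1_def by (intro mult_left_mono) auto
    then show ?thesis unfolding miW[OF q] by simp
  qed
  have I2: "(\<Sum>s\<in>UNIV. q s * mi_nats A P (concat_channel \<kappa> (V s))) \<le> I2" if q: "q \<in> pmfs_cost c \<Lambda>" for q
  proof -
    have "avg_mi_aux k PUX V q \<le> Sup ((\<lambda>q'. avg_mi_aux k PUX V q') ` pmfs_cost c \<Lambda>)"
    proof (rule cSup_upper)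
      have "avg_mi_aux k PUX V q \<le> (\<Sum>s\<in>UNIV. mi_aux k PUX (V s))" if "q \<in> pmfs_cost c \<Lambda>" for q
        unfolding avg_mi_aux_def
      proof (intro sum_mono)
        fix s :: 's
        have "q s \<le> (\<Sum>s\<in>UNIV. q s)"
          using that by (intro member_le_sum) (auto simp: pmfs_cost_def is_pmf_def)
        then have "q s \<le> 1" using that by (simp add: pmfs_cost_def is_pmf_def)
        then show "q s * mi_aux k PUX (V s) \<le> mi_aux k PUX (V s)"
          using mult_right_mono[of "q s" 1] miV0[of s] by simp
      qed
      then show "bdd_above ((\<lambda>q'. avg_mi_aux k PUX V q') ` pmfs_cost c \<Lambda>)"
        by (intro bdd_aboveI[of _ "\<Sum>s\<in>UNIV. mi_aux k PUX (V s)"]) auto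
    qed (use q in auto)
    then have "ln 2 * avg_mi_aux k PUX V q \<le> I2" unfolding I2_def by (intro mult_left_mono) auto
    moreover have "ln 2 * avg_mi_aux k PUX V q = (\<Sum>s\<in>UNIV. q s * mi_nats A P (concat_channel \<kappa> (V s)))"
      unfolding avg_mi_aux_def miV sum_distrib_left by (intro sum.cong) auto
    ultimately show ?thesis by simp
  qed
  have I2_0: "0 \<le> I2"
  proof -
    obtain q where q: "q \<in> pmfs_cost c \<Lambda>" using False by blast
    have "0 \<le> (\<Sum>s\<in>UNIV. q s * mi_nats A P (concat_channel \<kappa> (V s)))"
      using q mi_nats_nonneg[OF fin _ P1 V_st] Pp
      by (intro sum_nonneg mult_nonneg_nonneg) (auto simp: less_imp_le pmfs_cost_def is_pmf_def)
    then show ?thesis using I2[OF q] by linarith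
  qed
  have RI: "ln 2 * R \<le> I1 - I2"
    unfolding I1_def I2_def right_diff_distrib[symmetric] using R by (intro mult_left_mono) auto
  \<comment> \<open>Nonnegativity of \<open>R\<close> and \<open>I2\<close> passes to
    \<open>I1\<close>; \<open>universal_score_exists\<close> asks for it.\<close>
  have "0 \<le> ln 2 * R" using assms(5) by simp
  with RI I2_0 have I1_0: "0 \<le> I1" by linarith
  show ?thesis unfolding achievable_random_def
  proof (intro conjI allI impI assms(5))
    fix \<epsilon> :: real assume \<epsilon>: "0 < \<epsilon>"
    \<comment> \<open>The message exponent will lie \<open>4 * \<delta>\<close> below
      \<open>ln 2 * R\<close>, a rate loss of \<open>\<epsilon> / 2\<close> bits.\<close>
    define \<delta> where "\<delta> = \<epsilon> * ln 2 / 8"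
    have \<delta>: "0 < \<delta>" using \<epsilon> by (simp add: \<delta>_def)
    let ?\<W> = "(\<lambda>q. concat_channel \<kappa> (avg_channel W q)) ` pmfs_cost c \<Lambda>"
    obtain \<theta> where \<theta>: "\<And>y. (\<Sum>u\<in>A. P u * exp (\<theta> u y)) \<le> 1"
      and \<theta>_mean: "\<And>w. w \<in> ?\<W> \<Longrightarrow> I1 - \<delta> \<le> (\<Sum>u\<in>A. \<Sum>y\<in>UNIV. P u * w u y * \<theta> u y)"
    proof (rule universal_score_exists[of A P ?\<W> I1 \<delta>])
      fix w w' and t :: real assume "w \<in> ?\<W>" "w' \<in> ?\<W>" and t: "0 \<le> t" "t \<le> 1"
      then obtain q q' where q: "q \<in> pmfs_cost c \<Lambda>" "q' \<in> pmfs_cost c \<Lambda>"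
        and w: "w = concat_channel \<kappa> (avg_channel W q)" "w' = concat_channel \<kappa> (avg_channel W q')" by auto
      have "(\<lambda>u y. (1 - t) * w u y + t * w' u y) = concat_channel \<kappa> (avg_channel W (\<lambda>s. (1 - t) * q s + t * q' s))"
        unfolding w concat_avg_channel
        by (intro ext) (simp add: sum_distrib_left sum.distrib ring_distribs sum_subtractf mult.assoc)
      then show "(\<lambda>u y. (1 - t) * w u y + t * w' u y) \<in> ?\<W>"
        using pmfs_cost_convex[OF q t] by blast
    qed (use fin Pp P1 Wq_st I1 I1_0 False \<delta> in \<open>auto simp: less_imp_le\<close>)
    define d where "d s u z = ln (concat_channel \<kappa> (V s) u z / (\<Sum>u\<in>A. P u * concat_channel \<kappa> (V s) u z))" for s u z
    \<comment> \<open>A crude common bound on the score and all information densities; the summand 1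
      makes \<open>1 / Bd\<close> at most 1.\<close>
    define Bd where "Bd = 1 + (\<Sum>u\<in>A. \<Sum>y\<in>UNIV. \<bar>\<theta> u y\<bar>) + (\<Sum>s\<in>UNIV. \<Sum>u\<in>A. \<Sum>z\<in>UNIV. \<bar>d s u z\<bar>)"
    have nn: "0 \<le> (\<Sum>u\<in>A. \<Sum>y\<in>UNIV. \<bar>\<theta> u y\<bar>)" "0 \<le> (\<Sum>s\<in>UNIV. \<Sum>u\<in>A. \<Sum>z\<in>UNIV. \<bar>d s u z\<bar>)"
      by (intro sum_nonneg abs_ge_zero)+
    have Bd1: "1 \<le> Bd" unfolding Bd_def using nn by linarith
    have Bd\<theta>: "\<bar>\<theta> u y\<bar> \<le> Bd" if "u \<in> A" for u y
    proof -
      have "\<bar>\<theta> u y\<bar> \<le> (\<Sum>y\<in>UNIV. \<bar>\<theta> u y\<bar>)" by (rule member_le_sum) auto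
      also have "\<dots> \<le> (\<Sum>u\<in>A. \<Sum>y\<in>UNIV. \<bar>\<theta> u y\<bar>)"
        by (rule member_le_sum[of u A "\<lambda>u. \<Sum>y\<in>UNIV. \<bar>\<theta> u y\<bar>"]) (use that fin in \<open>auto intro: sum_nonneg\<close>)
      finally show ?thesis unfolding Bd_def using nn by linarith
    qed
    have Bdd: "\<bar>d s u z\<bar> \<le> Bd" if "u \<in> A" for s u z
    proof -
      have "\<bar>d s u z\<bar> \<le> (\<Sum>z\<in>UNIV. \<bar>d s u z\<bar>)" by (rule member_le_sum) auto
      also have "\<dots> \<le> (\<Sum>u\<in>A. \<Sum>z\<in>UNIV. \<bar>d s u z\<bar>)"
        by (rule member_le_sum[of u A "\<lambda>u. \<Sum>z\<in>UNIV. \<bar>d s u z\<bar>"]) (use that fin in \<open>auto intro: sum_nonneg\<close>)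
      also have "\<dots> \<le> (\<Sum>s\<in>UNIV. \<Sum>u\<in>A. \<Sum>z\<in>UNIV. \<bar>d s u z\<bar>)"
        by (rule member_le_sum[of s UNIV "\<lambda>s. \<Sum>u\<in>A. \<Sum>z\<in>UNIV. \<bar>d s u z\<bar>"]) (auto intro!: sum_nonneg)
      finally show ?thesis unfolding Bd_def using nn by linarith
    qed
    \<comment> \<open>The first entry makes the moment bounds applicable; the second keeps the
      quadratic term below half of the linear gain \<open>\<rho> * \<delta>\<close>, leaving the
      exponent \<open>\<tau>\<close>.\<close>
    define \<rho> where "\<rho> = min (1 / Bd) (\<delta> / (2 * Bd\<^sup>2))"
    have \<rho>: "0 < \<rho>" using Bd1 \<delta> by (simp add: \<rho>_def)
    have \<rho>_le: "\<rho> \<le> 1 / Bd" "\<rho> \<le> \<delta> / (2 * Bd\<^sup>2)" by (auto simp: \<rho>_def)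
    have \<rho>Bd: "\<rho> * Bd \<le> 1" using \<rho>_le(1) Bd1 by (simp add: field_simps)
    have "1 / Bd \<le> 1" using Bd1 by simp
    then have \<rho>1: "\<rho> \<le> 1" using \<rho>_le(1) by linarith
    have "\<rho> * Bd\<^sup>2 \<le> \<delta> / 2" using \<rho>_le(2) Bd1 by (simp add: field_simps)
    then have "\<rho> * (\<rho> * Bd\<^sup>2) \<le> \<rho> * (\<delta> / 2)" using \<rho> by (intro mult_left_mono) auto
    then have \<rho>2: "\<rho>\<^sup>2 * Bd\<^sup>2 \<le> \<rho> * \<delta> / 2" by (simp add: power2_eq_square mult.assoc)
    define \<tau> where "\<tau> = \<rho> * \<delta> / 2"
    have \<tau>: "0 < \<tau>" using \<rho> \<delta> by (simp add: \<tau>_def)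
    have "\<forall>\<^sub>F N in sequentially. 0 < N \<and> 1 * exp (- (real N * \<tau>)) < \<epsilon> / 2 \<and> 2 * exp (- (real N * \<delta>)) < \<epsilon> / 2
        \<and> 2 / \<rho> / ln 2 * exp (- (real N * \<tau>)) < \<epsilon>"
      using \<tau> \<delta> \<epsilon> by (intro eventually_conj eventually_exp_decay eventually_gt_at_top) auto
    then obtain N0 where N0: "\<And>N. N \<ge> N0 \<Longrightarrow> 0 < N \<and> 1 * exp (- (real N * \<tau>)) < \<epsilon> / 2
        \<and> 2 * exp (- (real N * \<delta>)) < \<epsilon> / 2 \<and> 2 / \<rho> / ln 2 * exp (- (real N * \<tau>)) < \<epsilon>"
      unfolding eventually_sequentially by blast
    show "\<exists>N0. \<forall>N\<ge>N0. \<exists>Mn G \<pi> f (\<phi> :: nat \<Rightarrow> 'y list \<Rightarrow> nat).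
        random_code N Mn G \<pi> f \<phi> \<and> R - \<epsilon> < log 2 (real Mn) / real N \<and>
        (\<forall>ss\<in>seqs N UNIV. cost_seq c ss \<le> \<Lambda> \<longrightarrow> max_err W N Mn G \<pi> f \<phi> ss < \<epsilon>) \<and>
        (\<forall>ss\<in>seqs N UNIV. cost_seq c ss \<le> \<Lambda> \<longrightarrow> secrecy_leak V N Mn G \<pi> f \<phi> ss < \<epsilon>)"
    proof (rule exI[of _ N0], intro allI impI)
      fix N assume "N0 \<le> N"
      note N = N0[OF this]
      \<comment> \<open>The threshold lies \<open>\<delta>\<close> below the guaranteed mean
        \<open>I1 - \<delta>\<close>, and \<open>L\<close> exceeds the covering rate by
        \<open>\<delta>\<close>. The exponents of \<open>Mn\<close>, \<open>L\<close> and
        \<open>exp (- a)\<close> then add up to at most \<open>- \<delta>\<close> per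
        letter.\<close>
      define Mn where "Mn = nat \<lceil>exp (real N * (ln 2 * R - 4 * \<delta>))\<rceil>"
      define L where "L = nat \<lceil>exp (real N * (I2 + \<delta>))\<rceil>"
      define a where "a = real N * (I1 - 2 * \<delta>)"
      have Mn: "0 < Mn" "exp (real N * (ln 2 * R - 4 * \<delta>)) \<le> real Mn"
        "real Mn - 1 \<le> exp (real N * (ln 2 * R - 4 * \<delta>))"
        unfolding Mn_def by (rule nat_ceiling_bounds; simp)+
      have L: "0 < L" "exp (real N * (I2 + \<delta>)) \<le> real L" "real L - 1 \<le> exp (real N * (I2 + \<delta>))"
        unfolding L_def by (rule nat_ceiling_bounds; simp)+
      \<comment> \<open>Rounding at most doubles \<open>L\<close>, whose exponent is nonnegative.
        The exponent of \<open>Mn\<close> may be negative, so its rounding is absorbed by counting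
        only \<open>Mn - 1\<close> wrong messages.\<close>
      have "1 \<le> exp (real N * (I2 + \<delta>))" using I2_0 \<delta> by simp
      then have L2: "real L \<le> 2 * exp (real N * (I2 + \<delta>))" using L(3) by linarith
      obtain G \<pi> f and \<phi> :: "nat \<Rightarrow> 'y list \<Rightarrow> nat" where rc: "random_code N Mn G \<pi> f \<phi>"
        and err: "\<And>ss. ss \<in> seqs N UNIV \<Longrightarrow> max_err W N Mn G \<pi> f \<phi> ss
           \<le> exp (\<rho> * a - \<rho> * (\<Sum>i<N. \<Sum>u\<in>A. \<Sum>y\<in>UNIV. P u * concat_channel \<kappa> (W (ss ! i)) u y * \<theta> u y)
                  + real N * (\<rho>\<^sup>2 * Bd\<^sup>2)) + (real Mn - 1) * real L * exp (- a)"
        and leak: "\<And>ss. ss \<in> seqs N UNIV \<Longrightarrow> secrecy_leak V N Mn G \<pi> f \<phi> ss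
           \<le> 2 / \<rho> * real L powr (- \<rho>) *
              exp (\<rho> * (\<Sum>i<N. mi_nats A P (concat_channel \<kappa> (V (ss ! i)))) + real N * (\<rho>\<^sup>2 * Bd\<^sup>2)) / ln 2"
        by (rule random_coding_bounds[where \<theta> = \<theta> and N = N and a = a, OF W V fin Pp P1 \<kappa> \<theta> Bd\<theta>
              Bdd[unfolded d_def] \<rho> \<rho>1 \<rho>Bd Mn(1) L(1)]) (assumption+, rule that)
      have N\<tau>: "real N * (\<rho>\<^sup>2 * Bd\<^sup>2) \<le> real N * \<tau>" using \<rho>2 unfolding \<tau>_def by (intro mult_left_mono) auto
      have "R - \<epsilon> < log 2 (real Mn) / real N"
      proof -
        have "real N * (ln 2 * R - 4 * \<delta>) \<le> ln (real Mn)" using Mn by (simp add: ln_ge_iff)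
        then have "real N * (ln 2 * R - 4 * \<delta>) / (ln 2 * real N) \<le> ln (real Mn) / (ln 2 * real N)"
          by (intro divide_right_mono) auto
        moreover have "real N * (ln 2 * R - 4 * \<delta>) / (ln 2 * real N) = R - \<epsilon> / 2"
          using N by (simp add: \<delta>_def field_simps)
        ultimately show ?thesis using \<epsilon> by (simp add: log_def)
      qed
      moreover have "max_err W N Mn G \<pi> f \<phi> ss < \<epsilon>" if ss: "ss \<in> seqs N UNIV" "cost_seq c ss \<le> \<Lambda>" for ss
      proof -
        obtain q where q: "q \<in> pmfs_cost c \<Lambda>"
          and sum_q: "\<And>g :: 's \<Rightarrow> real. (\<Sum>i<N. g (ss ! i)) = real N * (\<Sum>s\<in>UNIV. q s * g s)"
          using empirical_pmf[OF ss(1) _ ss(2)] N by blast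
        have "(\<Sum>i<N. \<Sum>u\<in>A. \<Sum>y\<in>UNIV. P u * concat_channel \<kappa> (W (ss ! i)) u y * \<theta> u y)
            = real N * (\<Sum>s\<in>UNIV. q s * (\<Sum>u\<in>A. \<Sum>y\<in>UNIV. P u * concat_channel \<kappa> (W s) u y * \<theta> u y))"
          by (rule sum_q)
        \<comment> \<open>The mean score is linear in the channel, so the empirical average over
          states is the mean under the averaged channel, where the optimality bound applies.\<close>
        also have "(\<Sum>s\<in>UNIV. q s * (\<Sum>u\<in>A. \<Sum>y\<in>UNIV. P u * concat_channel \<kappa> (W s) u y * \<theta> u y))
            = (\<Sum>u\<in>A. \<Sum>y\<in>UNIV. P u * concat_channel \<kappa> (avg_channel W q) u y * \<theta> u y)"
          unfolding concat_avg_channel sum_distrib_left sum_distrib_right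
          by (subst sum_rotate) (simp add: mult_ac)
        finally have "real N * (I1 - \<delta>) \<le> (\<Sum>i<N. \<Sum>u\<in>A. \<Sum>y\<in>UNIV. P u * concat_channel \<kappa> (W (ss ! i)) u y * \<theta> u y)"
          using \<theta>_mean[of "concat_channel \<kappa> (avg_channel W q)"] q by (simp add: mult_left_mono)
        then have "\<rho> * (real N * (I1 - \<delta>)) \<le> \<rho> * (\<Sum>i<N. \<Sum>u\<in>A. \<Sum>y\<in>UNIV. P u * concat_channel \<kappa> (W (ss ! i)) u y * \<theta> u y)"
          using \<rho> by (intro mult_left_mono) auto
        \<comment> \<open>Per letter \<open>\<rho> * \<delta> = 2 * \<tau>\<close> is gained and
          \<open>\<tau>\<close> is spent on the quadratic term.\<close>
        moreover have "\<rho> * a - \<rho> * (real N * (I1 - \<delta>)) + real N * \<tau> = - (real N * \<tau>)"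
          unfolding a_def \<tau>_def by (simp add: field_simps)
        ultimately have "\<rho> * a - \<rho> * (\<Sum>i<N. \<Sum>u\<in>A. \<Sum>y\<in>UNIV. P u * concat_channel \<kappa> (W (ss ! i)) u y * \<theta> u y)
                  + real N * (\<rho>\<^sup>2 * Bd\<^sup>2) \<le> - (real N * \<tau>)"
          using N\<tau> by linarith
        then have "exp (\<rho> * a - \<rho> * (\<Sum>i<N. \<Sum>u\<in>A. \<Sum>y\<in>UNIV. P u * concat_channel \<kappa> (W (ss ! i)) u y * \<theta> u y)
                  + real N * (\<rho>\<^sup>2 * Bd\<^sup>2)) \<le> exp (- (real N * \<tau>))"
          by (rule exp_le_cancel_iff[THEN iffD2])
        moreover have "(real Mn - 1) * real L * exp (- a)
            \<le> exp (real N * (ln 2 * R - 4 * \<delta>)) * (2 * exp (real N * (I2 + \<delta>))) * exp (- a)"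
          using Mn L2 by (intro mult_right_mono mult_mono) auto
        moreover have "\<dots> = 2 * exp (real N * (ln 2 * R - I1 + I2) - real N * \<delta>)"
          unfolding a_def by (simp add: exp_add[symmetric] algebra_simps)
        moreover have "real N * (ln 2 * R - I1 + I2) \<le> 0"
          using RI by (intro mult_nonneg_nonpos) auto
        then have "exp (real N * (ln 2 * R - I1 + I2) - real N * \<delta>) \<le> exp (- (real N * \<delta>))" by simp
        ultimately show ?thesis using err[OF ss(1)] N by linarith
      qed
      moreover have "secrecy_leak V N Mn G \<pi> f \<phi> ss < \<epsilon>" if ss: "ss \<in> seqs N UNIV" "cost_seq c ss \<le> \<Lambda>" for ss
      proof -
        obtain q where q: "q \<in> pmfs_cost c \<Lambda>"
          and sum_q: "\<And>g :: 's \<Rightarrow> real. (\<Sum>i<N. g (ss ! i)) = real N * (\<Sum>s\<in>UNIV. q s * g s)"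
          using empirical_pmf[OF ss(1) _ ss(2)] N by blast
        define X where "X = (\<Sum>i<N. mi_nats A P (concat_channel \<kappa> (V (ss ! i))))"
        have "X \<le> real N * I2"
          unfolding X_def sum_q[of "\<lambda>s. mi_nats A P (concat_channel \<kappa> (V s))"]
          using I2[OF q] by (intro mult_left_mono) auto
        then have "\<rho> * X \<le> \<rho> * (real N * I2)" using \<rho> by (intro mult_left_mono) auto
        then have "\<rho> * X + real N * (\<rho>\<^sup>2 * Bd\<^sup>2) \<le> \<rho> * (real N * I2) + real N * \<tau>" using N\<tau> by linarith
        moreover have "real L powr (- \<rho>) \<le> exp (real N * (I2 + \<delta>)) powr (- \<rho>)"
          using L \<rho> by (intro powr_mono2') auto
        ultimately have "real L powr (- \<rho>) * exp (\<rho> * X + real N * (\<rho>\<^sup>2 * Bd\<^sup>2))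
            \<le> exp (real N * (I2 + \<delta>)) powr (- \<rho>) * exp (\<rho> * (real N * I2) + real N * \<tau>)"
          by (intro mult_mono) auto
        \<comment> \<open>\<open>I2\<close> cancels; as for the error, the excess
          \<open>\<rho> * \<delta> = 2 * \<tau>\<close> pays for the quadratic term.\<close>
        also have "\<dots> = exp (- (real N * \<tau>))"
          by (simp add: powr_def exp_add[symmetric] \<tau>_def field_simps)
        finally have "2 / \<rho> / ln 2 * (real L powr (- \<rho>) * exp (\<rho> * X + real N * (\<rho>\<^sup>2 * Bd\<^sup>2)))
            \<le> 2 / \<rho> / ln 2 * exp (- (real N * \<tau>))"
          using \<rho> by (intro mult_left_mono) auto
        moreover have "2 / \<rho> * real L powr (- \<rho>) * exp (\<rho> * X + real N * (\<rho>\<^sup>2 * Bd\<^sup>2)) / ln 2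
            = 2 / \<rho> / ln 2 * (real L powr (- \<rho>) * exp (\<rho> * X + real N * (\<rho>\<^sup>2 * Bd\<^sup>2)))"
          by simp
        ultimately show ?thesis using leak[OF ss(1)] N unfolding X_def[symmetric] by linarith
      qed
      ultimately show "\<exists>Mn G \<pi> f (\<phi> :: nat \<Rightarrow> 'y list \<Rightarrow> nat).
        random_code N Mn G \<pi> f \<phi> \<and> R - \<epsilon> < log 2 (real Mn) / real N \<and>
        (\<forall>ss\<in>seqs N UNIV. cost_seq c ss \<le> \<Lambda> \<longrightarrow> max_err W N Mn G \<pi> f \<phi> ss < \<epsilon>) \<and>
        (\<forall>ss\<in>seqs N UNIV. cost_seq c ss \<le> \<Lambda> \<longrightarrow> secrecy_leak V N Mn G \<pi> f \<phi> ss < \<epsilon>)"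
        using rc by blast
    qed
  qed
qed

end
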